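(* There is a deterministic algorithm with the following property. Given a positive integer $n$ and oracle access to a function $f$ on the symmetric group $S_n$ that is promised to be an irreducible character of $S_n$ (i.e. $f=\chi_\lambda$ for some partition $\lambda$ of $n$, not known to the algorithm), the algorithm determines which irreducible character $f$ is (i.e. it determines $\lambda$), using a number of oracle queries that is bounded by a polynomial in $n$.
   Context: The irreducible (complex) characters of $S_n$ are indexed in the standard way by the partitions $\lambda$ of $n$; $\chi_\lambda$ denotes the one indexed by $\lambda$. Oracle access to $f$ means that the only way the algorithm can obtain information about $f$ is to submit queries $\pi\in S_n$ of its own choosing to an oracle, which truthfully returns the value $f(\pi)$. Queries may be adaptive: the results of previous queries may be examined when deciding which query to submit next. The theorem concerns query complexity (the number of queries), not computational complexity; the polynomial bound is a fixed polynomial valid for all $n$ and all irreducible characters $f$ of $S_n$. *)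

theory Defs
  imports
    "Jordan_Normal_Form.VS_Connect"
    "HOL-Algebra.Sym_Groups"
    "HOL-Library.Function_Algebras"
    "HOL-Computational_Algebra.Polynomial"
begin

section \<open>Irreducible complex characters of the symmetric group\<close>

text \<open>
  The monoid of units of the matrix ring is the general linear group, so this is a homomorphism
  from the symmetric group on \<open>{1..n}\<close> to \<open>GL\<^sub>d\<close> over the complex numbers.
\<close>

definition matrix_representation :: "nat \<Rightarrow> nat \<Rightarrow> ((nat \<Rightarrow> nat) \<Rightarrow> complex mat) \<Rightarrow> bool" where
  "matrix_representation n d \<rho> \<longleftrightarrow>
     \<rho> \<in> hom (sym_group n) (units_of (ring_mat TYPE(complex) d ()))"

definition irreducible_representation :: "nat \<Rightarrow> nat \<Rightarrow> ((nat \<Rightarrow> nat) \<Rightarrow> complex mat) \<Rightarrow> bool" where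
  "irreducible_representation n d \<rho> \<longleftrightarrow>
     matrix_representation n d \<rho> \<and> d > 0 \<and>
     (\<forall>W. VectorSpace.subspace class_ring W (module_vec TYPE(complex) d) \<and>
          (\<forall>\<pi>\<in>carrier (sym_group n). \<forall>w\<in>W. \<rho> \<pi> *\<^sub>v w \<in> W) \<longrightarrow>
          W = {0\<^sub>v d} \<or> W = carrier_vec d)"

definition mat_trace :: "complex mat \<Rightarrow> complex" where
  "mat_trace A = (\<Sum>i<dim_row A. A $$ (i, i))"

text \<open>A function on the symmetric group is a HOL function whose values elsewhere are irrelevant.\<close>

definition irreducible_character :: "nat \<Rightarrow> ((nat \<Rightarrow> nat) \<Rightarrow> complex) \<Rightarrow> bool" where
  "irreducible_character n f \<longleftrightarrow>
     (\<exists>d \<rho>. irreducible_representation n d \<rho> \<and>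
            (\<forall>\<pi>\<in>carrier (sym_group n). f \<pi> = mat_trace (\<rho> \<pi>)))"


section \<open>Specht modules and the characters indexed by partitions\<close>

definition is_partition :: "nat \<Rightarrow> nat list \<Rightarrow> bool" where
  "is_partition n lam \<longleftrightarrow> sorted_wrt (\<ge>) lam \<and> 0 \<notin> set lam \<and> sum_list lam = n"

definition young_diagram :: "nat list \<Rightarrow> (nat \<times> nat) set" where
  "young_diagram lam = {(i, j). i < length lam \<and> j < lam ! i}"

definition is_tableau :: "nat list \<Rightarrow> (nat \<times> nat \<Rightarrow> nat) \<Rightarrow> bool" where
  "is_tableau lam t \<longleftrightarrow> bij_betw t (young_diagram lam) {1..sum_list lam}"

text \<open>The tabloid of a tableau, i.e. its row equivalence class, is the list of its row sets.\<close>

definition tabloid :: "nat list \<Rightarrow> (nat \<times> nat \<Rightarrow> nat) \<Rightarrow> nat set list" where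
  "tabloid lam t = map (\<lambda>i. (\<lambda>j. t (i, j)) ` {..<lam ! i}) [0..<length lam]"

definition column_stabilizer :: "nat list \<Rightarrow> (nat \<times> nat \<Rightarrow> nat) \<Rightarrow> (nat \<Rightarrow> nat) set" where
  "column_stabilizer lam t =
     {\<pi> \<in> carrier (sym_group (sum_list lam)).
        \<forall>j. \<pi> ` t ` {c \<in> young_diagram lam. snd c = j} = t ` {c \<in> young_diagram lam. snd c = j}}"

text \<open>
  Formal complex linear combinations of tabloids are coefficient functions
  \<open>nat set list \<Rightarrow> complex\<close>. The polytabloid of \<open>t\<close> is the signed sum of the
  tabloids of \<open>\<pi> \<circ> t\<close> over the column stabilizer of \<open>t\<close>.
\<close>

definition polytabloid :: "nat list \<Rightarrow> (nat \<times> nat \<Rightarrow> nat) \<Rightarrow> nat set list \<Rightarrow> complex" where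
  "polytabloid lam t =
     (\<lambda>T. \<Sum>\<pi>\<in>column_stabilizer lam t.
            of_int (sign \<pi>) * (if tabloid lam (\<pi> \<circ> t) = T then 1 else 0))"

global_interpretation cfun: vector_space "\<lambda>(c::complex) (v::'a \<Rightarrow> complex) x. c * v x"
  by unfold_locales (auto simp: fun_eq_iff algebra_simps)

definition specht_module :: "nat list \<Rightarrow> (nat set list \<Rightarrow> complex) set" where
  "specht_module lam = cfun.span {polytabloid lam t | t. is_tableau lam t}"

text \<open>
  The linear extension of the action \<open>T \<mapsto> \<pi> T\<close> on tabloids: the coefficient of \<open>T\<close>
  in \<open>\<pi> v\<close> is the coefficient of \<open>\<pi>\<^sup>-\<^sup>1 T\<close> in \<open>v\<close>.
\<close>

definition tabloid_action ::
    "(nat \<Rightarrow> nat) \<Rightarrow> (nat set list \<Rightarrow> complex) \<Rightarrow> nat set list \<Rightarrow> complex" where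
  "tabloid_action \<pi> v = (\<lambda>T. v (map (image (inv_into UNIV \<pi>)) T))"

text \<open>
  The trace of a linear endomorphism \<open>F\<close> of a finite-dimensional subspace \<open>V\<close>, computed in an
  arbitrary basis; the value does not depend on the basis.
\<close>

definition trace_on :: "('a \<Rightarrow> complex) set \<Rightarrow> (('a \<Rightarrow> complex) \<Rightarrow> 'a \<Rightarrow> complex) \<Rightarrow> complex" where
  "trace_on V F =
     (let B = (SOME B. cfun.independent B \<and> cfun.span B = V)
      in \<Sum>b\<in>B. cfun.representation B (F b) b)"

definition chi :: "nat list \<Rightarrow> (nat \<Rightarrow> nat) \<Rightarrow> complex" where
  "chi lam \<pi> = trace_on (specht_module lam) (tabloid_action \<pi>)"


section \<open>Deterministic adaptive query algorithms\<close>

text \<open>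
  An algorithm either halts with a result or submits a permutation to the oracle and continues
  depending on the complex number returned.
\<close>

datatype 'r query_algorithm =
    Halt 'r
  | Query "nat \<Rightarrow> nat" "complex \<Rightarrow> 'r query_algorithm"

primrec answer :: "'r query_algorithm \<Rightarrow> ((nat \<Rightarrow> nat) \<Rightarrow> complex) \<Rightarrow> 'r" where
  "answer (Halt r) f = r"
| "answer (Query \<pi> k) f = answer (k (f \<pi>)) f"

primrec queries :: "'r query_algorithm \<Rightarrow> ((nat \<Rightarrow> nat) \<Rightarrow> complex) \<Rightarrow> (nat \<Rightarrow> nat) list" where
  "queries (Halt r) f = []"
| "queries (Query \<pi> k) f = \<pi> # queries (k (f \<pi>)) f"

end

theory Submission
  imports Defs "Jordan_Normal_Form.Spectral_Radius"
begin

text \<open>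
  The algorithm asks for the values on the cycles \<open>(1 2 \<dots> k)\<close> for \<open>k = 1, \<dots>, n\<close>. These determine an
  irreducible character: by Schur's lemma the normalized character \<open>\<chi>(g) / \<chi>(1)\<close> turns averages of
  \<open>u g u\<^sup>-\<^sup>1 g'\<close> over \<open>u\<close> into products, and this expresses the value on a product of disjoint
  cycles by values on the factors and on permutations moving fewer points.

  The characters of Specht modules are irreducible because the column antisymmetrizer of a tableau \<open>t\<close>
  maps the whole tabloid module into the line spanned by the polytabloid of \<open>t\<close>. They are pairwise distinct
  because this antisymmetrizer has nonzero trace on its own Specht module, but kills the tabloid modules
  of all shapes not dominated by the shape of \<open>t\<close>. Counting cycle types shows that there are no other
  irreducible characters.
\<close>

section \<open>Matrix representations with scalar commutant\<close>

text \<open>In the centre of the group algebra, the class sum of a cycle times the class sum of a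
  disjoint remainder is a nonzero multiple of the class sum of the whole plus class sums of smaller
  support; since central characters are multiplicative, the cycles suffice. The case
  \<open>k = 1\<close> is the identity, whose value is the degree that normalizes a character. The
  queries are fixed in advance, and decoding is a bare choice among partitions: what has to be
  proved is that two characters agreeing on the cycles agree everywhere.

  An unknown \<open>f\<close> arrives as a trace of matrices indexed by \<open>{..<d}\<close>,
  whereas \<open>chi lam\<close> is a trace in an arbitrarily chosen basis of a function space. Both
  become coefficient families \<open>R g i j\<close> over a finite index set of any type, so that
  basis vectors can index themselves. Orthogonality is expressed through the value at the inverse
  element in place of the complex conjugate, which keeps all pairings bilinear and computable from
  the multiplication rule alone.\<close>

locale finite_matrix_rep = group G for G (structure) +
  fixes I :: "'i set" and R :: "'g \<Rightarrow> 'i \<Rightarrow> 'i \<Rightarrow> complex"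
  assumes finite_carrier: "finite (carrier G)"
    and finite_index: "finite I"
    and rep_one: "i \<in> I \<Longrightarrow> j \<in> I \<Longrightarrow> R \<one> i j = of_bool (i = j)"
    and rep_mult: "g \<in> carrier G \<Longrightarrow> h \<in> carrier G \<Longrightarrow> i \<in> I \<Longrightarrow> j \<in> I \<Longrightarrow>
           R (g \<otimes> h) i j = (\<Sum>k\<in>I. R g i k * R h k j)"
begin

definition character :: "'g \<Rightarrow> complex" where
  "character g = (\<Sum>i\<in>I. R g i i)"

lemma character_one: "character \<one> = of_nat (card I)"
  by (simp add: character_def rep_one)

lemma character_commute:
  assumes "g \<in> carrier G" "h \<in> carrier G"
  shows "character (g \<otimes> h) = character (h \<otimes> g)"
proof -
  have "character (g \<otimes> h) = (\<Sum>i\<in>I. \<Sum>k\<in>I. R g i k * R h k i)"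
    using assms by (simp add: character_def rep_mult)
  also have "\<dots> = (\<Sum>k\<in>I. \<Sum>i\<in>I. R g i k * R h k i)"
    by (rule sum.swap)
  also have "\<dots> = character (h \<otimes> g)"
    using assms by (simp add: character_def rep_mult mult.commute)
  finally show ?thesis .
qed

lemma character_conjugate:
  assumes "g \<in> carrier G" "h \<in> carrier G"
  shows "character (h \<otimes> g \<otimes> inv h) = character g"
  using assms by (simp add: character_commute[of "h \<otimes> g"] m_assoc[symmetric])

lemma sum_translate_left:
  assumes "k \<in> carrier G"
  shows "(\<Sum>h\<in>carrier G. F (k \<otimes> h)) = (\<Sum>h\<in>carrier G. F h)"
  using assms
  by (intro sum.reindex_bij_witness[of _ "\<lambda>h. inv k \<otimes> h" "\<lambda>h. k \<otimes> h"])
     (auto simp: m_assoc[symmetric])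

end

text \<open>\<open>A\<close> is the average (up to a factor) of the matrix unit with entry 1 at
  \<open>(p, q)\<close>, with \<open>g\<close> acting on the left and its inverse on the right.
  Multiplying by \<open>k\<close> only translates the summation variable.\<close>

lemma averaged_intertwiner:
  assumes "finite_matrix_rep G I R" "finite_matrix_rep G J S"
    and k: "k \<in> carrier G" and p: "p \<in> I" "q \<in> J" and ij: "i \<in> I" "j \<in> J"
  defines "A \<equiv> \<lambda>i j. \<Sum>g\<in>carrier G. R g i p * S (inv\<^bsub>G\<^esub> g) q j"
  shows "(\<Sum>l\<in>I. R k i l * A l j) = (\<Sum>l\<in>J. A i l * S k l j)"
proof -
  interpret R: finite_matrix_rep G I R by fact
  interpret S: finite_matrix_rep G J S by fact
  let ?inv = "m_inv G"
  have "(\<Sum>l\<in>I. R k i l * A l j) = (\<Sum>g\<in>carrier G. \<Sum>l\<in>I. R k i l * R g l p * S (?inv g) q j)"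
    unfolding A_def by (simp add: sum_distrib_left mult.assoc sum.swap[of _ "carrier G"])
  also have "\<dots> = (\<Sum>g\<in>carrier G. R (k \<otimes>\<^bsub>G\<^esub> g) i p * S (?inv g) q j)"
    using k p ij by (intro sum.cong refl) (simp add: R.rep_mult sum_distrib_right)
  \<comment> \<open>Rewriting the inverse of \<open>g\<close> as the inverse of \<open>k g\<close>
    times \<open>k\<close> makes the summand a function of \<open>k g\<close> alone.\<close>
  also have "\<dots> = (\<Sum>g\<in>carrier G. R (k \<otimes>\<^bsub>G\<^esub> g) i p * S (?inv (k \<otimes>\<^bsub>G\<^esub> g) \<otimes>\<^bsub>G\<^esub> k) q j)"
    using k by (intro sum.cong refl) (simp add: R.inv_mult_group R.m_assoc)
  also have "\<dots> = (\<Sum>g\<in>carrier G. R g i p * S (?inv g \<otimes>\<^bsub>G\<^esub> k) q j)"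
    by (rule R.sum_translate_left[OF k, of "\<lambda>g. R g i p * S (?inv g \<otimes>\<^bsub>G\<^esub> k) q j"])
  also have "\<dots> = (\<Sum>g\<in>carrier G. \<Sum>l\<in>J. R g i p * S (?inv g) q l * S k l j)"
    using k p ij by (intro sum.cong refl) (simp add: S.rep_mult sum_distrib_left mult.assoc)
  also have "\<dots> = (\<Sum>l\<in>J. A i l * S k l j)"
    unfolding A_def by (simp add: sum_distrib_right sum.swap[of _ "carrier G"])
  finally show ?thesis .
qed

text \<open>
  Schur's lemma as an axiom: irreducible matrix representations and Specht modules enter the proof only
  through the fact that every matrix commuting with them is scalar.
\<close>

locale schurian_rep = finite_matrix_rep +
  assumes index_nonempty: "I \<noteq> {}"
    and schur: "(\<And>g i j. g \<in> carrier G \<Longrightarrow> i \<in> I \<Longrightarrow> j \<in> I \<Longrightarrow>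
             (\<Sum>k\<in>I. R g i k * A k j) = (\<Sum>k\<in>I. A i k * R g k j)) \<Longrightarrow>
           \<exists>c. \<forall>i\<in>I. \<forall>j\<in>I. A i j = c * of_bool (i = j)"
begin

lemma card_index_nonzero: "of_nat (card I) \<noteq> (0 :: complex)"
  using finite_index index_nonempty by simp

text \<open>The sum \<open>A\<close> of the matrices of all conjugates of \<open>g\<close> commutes
  with the representation, so it is a scalar \<open>c\<close>, and its trace determines
  \<open>c\<close>. Multiplying by the matrix of \<open>g'\<close> and taking the trace again gives
  the formula.\<close>

lemma character_product:
  assumes g: "g \<in> carrier G" and g': "g' \<in> carrier G"
  shows "of_nat (card I) * (\<Sum>h\<in>carrier G. character (h \<otimes> g \<otimes> inv h \<otimes> g')) =
         of_nat (card (carrier G)) * character g * character g'"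
proof -
  define A where "A = (\<lambda>i j. \<Sum>h\<in>carrier G. R (h \<otimes> g \<otimes> inv h) i j)"
  have "(\<Sum>l\<in>I. R k i l * A l j) = (\<Sum>l\<in>I. A i l * R k l j)"
    if k: "k \<in> carrier G" and ij: "i \<in> I" "j \<in> I" for k i j
  proof -
    have "(\<Sum>l\<in>I. R k i l * A l j) = (\<Sum>h\<in>carrier G. \<Sum>l\<in>I. R k i l * R (h \<otimes> g \<otimes> inv h) l j)"
      unfolding A_def by (simp add: sum_distrib_left sum.swap[of _ "carrier G"])
    also have "\<dots> = (\<Sum>h\<in>carrier G. R (k \<otimes> h \<otimes> g \<otimes> inv (k \<otimes> h) \<otimes> k) i j)"
      using k ij g
      by (intro sum.cong refl) (simp add: rep_mult[symmetric] inv_mult_group m_assoc)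
    also have "\<dots> = (\<Sum>h\<in>carrier G. R (h \<otimes> g \<otimes> inv h \<otimes> k) i j)"
      by (rule sum_translate_left[OF k, of "\<lambda>h. R (h \<otimes> g \<otimes> inv h \<otimes> k) i j"])
    also have "\<dots> = (\<Sum>h\<in>carrier G. \<Sum>l\<in>I. R (h \<otimes> g \<otimes> inv h) i l * R k l j)"
      using k ij g by (intro sum.cong refl) (simp add: rep_mult)
    also have "\<dots> = (\<Sum>l\<in>I. A i l * R k l j)"
      unfolding A_def by (simp add: sum_distrib_right sum.swap[of _ "carrier G"])
    finally show ?thesis .
  qed
  then obtain c where c: "\<And>i j. i \<in> I \<Longrightarrow> j \<in> I \<Longrightarrow> A i j = c * of_bool (i = j)"
    using schur[of A] by blast
  have "of_nat (card I) * c = (\<Sum>i\<in>I. A i i)"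
    by (simp add: c)
  also have "\<dots> = (\<Sum>h\<in>carrier G. character (h \<otimes> g \<otimes> inv h))"
    unfolding A_def character_def by (rule sum.swap)
  also have "\<dots> = of_nat (card (carrier G)) * character g"
    using g by (simp add: character_conjugate)
  finally have trace: "of_nat (card I) * c = of_nat (card (carrier G)) * character g" .
  have "(\<Sum>h\<in>carrier G. character (h \<otimes> g \<otimes> inv h \<otimes> g')) =
        (\<Sum>h\<in>carrier G. \<Sum>i\<in>I. \<Sum>l\<in>I. R (h \<otimes> g \<otimes> inv h) i l * R g' l i)"
    using g g' by (simp add: character_def rep_mult)
  also have "\<dots> = (\<Sum>i\<in>I. \<Sum>l\<in>I. A i l * R g' l i)"
    unfolding A_def by (simp add: sum_distrib_right sum.swap[of _ "carrier G"])
  also have "\<dots> = (\<Sum>i\<in>I. \<Sum>l\<in>I. if i = l then c * R g' i i else 0)"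
    by (intro sum.cong refl) (simp add: c)
  also have "\<dots> = c * character g'"
    by (simp add: finite_index character_def sum_distrib_left)
  finally show ?thesis
    using trace by (simp add: mult.assoc[symmetric])
qed

text \<open>Schur orthogonality for pairs of diagonal coefficients, summed over all pairs: only the
  \<open>card I\<close> pairs with \<open>p = q\<close> contribute.\<close>

lemma character_norm:
  "(\<Sum>g\<in>carrier G. character g * character (inv g)) = of_nat (card (carrier G))"
proof -
  have entry: "(\<Sum>g\<in>carrier G. R g p p * R (inv g) q q) =
      of_bool (p = q) * of_nat (card (carrier G)) / of_nat (card I)"
    if pq: "p \<in> I" "q \<in> I" for p q
  proof -
    define A where "A = (\<lambda>i j. \<Sum>g\<in>carrier G. R g i p * R (inv g) q j)"
    have rep: "finite_matrix_rep G I R" by unfold_locales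
    have "\<exists>c. \<forall>i\<in>I. \<forall>j\<in>I. A i j = c * of_bool (i = j)"
      by (rule schur, unfold A_def, rule averaged_intertwiner[OF rep rep _ pq])
    then obtain c where c: "\<And>i j. i \<in> I \<Longrightarrow> j \<in> I \<Longrightarrow> A i j = c * of_bool (i = j)"
      by blast
    \<comment> \<open>The trace fixes the scalar: the matrix of the inverse of \<open>g\<close>
      times that of \<open>g\<close> is the identity, so every group element contributes its
      \<open>(q, p)\<close> entry.\<close>
    have "of_nat (card I) * c = (\<Sum>i\<in>I. A i i)"
      by (simp add: c)
    also have "\<dots> = (\<Sum>g\<in>carrier G. \<Sum>i\<in>I. R (inv g) q i * R g i p)"
      unfolding A_def by (subst sum.swap) (simp add: mult.commute)
    also have "\<dots> = of_bool (p = q) * of_nat (card (carrier G))"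
      using pq by (simp add: rep_mult[symmetric] rep_one eq_commute[of q])
    finally have "c = of_bool (p = q) * of_nat (card (carrier G)) / of_nat (card I)"
      using card_index_nonzero by (simp add: field_simps)
    then show ?thesis
      using c[OF pq] by (auto simp: A_def)
  qed
  have "(\<Sum>g\<in>carrier G. character g * character (inv g)) =
        (\<Sum>p\<in>I. \<Sum>q\<in>I. \<Sum>g\<in>carrier G. R g p p * R (inv g) q q)"
    unfolding character_def by (simp add: sum_product sum.swap[of _ "carrier G"])
  also have "\<dots> = (\<Sum>p\<in>I. \<Sum>q\<in>I. if p = q then of_nat (card (carrier G)) / of_nat (card I) else 0)"
    by (intro sum.cong refl) (simp add: entry)
  also have "\<dots> = of_nat (card (carrier G))"
    using card_index_nonzero finite_index by simp
  finally show ?thesis .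
qed

end

text \<open>The axiom \<open>schur\<close> speaks of matrices commuting with one representation, not
  of maps between two. Hence intertwiners \<open>A\<close> and \<open>B\<close> in both directions
  are built; \<open>AB\<close> and \<open>BA\<close> are then scalar, and comparing traces makes the
  characters proportional with factor 1.\<close>

lemma characters_eq_if_not_orthogonal:
  assumes "schurian_rep G I R" "schurian_rep G J S"
  assumes pairing: "(\<Sum>g\<in>carrier G. finite_matrix_rep.character I R g *
                      finite_matrix_rep.character J S (inv\<^bsub>G\<^esub> g)) \<noteq> 0"
    and g: "g \<in> carrier G"
  shows "finite_matrix_rep.character I R g = finite_matrix_rep.character J S g"
proof -
  interpret R: schurian_rep G I R by fact
  interpret S: schurian_rep G J S by fact
  let ?inv = "m_inv G"
  have Rrep: "finite_matrix_rep G I R" and Srep: "finite_matrix_rep G J S"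
    by unfold_locales
  have "(\<Sum>g\<in>carrier G. R.character g * S.character (?inv g)) =
        (\<Sum>p\<in>I. \<Sum>q\<in>J. \<Sum>g\<in>carrier G. R g p p * S (?inv g) q q)"
    unfolding R.character_def S.character_def by (simp add: sum_product sum.swap[of _ "carrier G"])
  with pairing obtain p where p: "p \<in> I" and "(\<Sum>q\<in>J. \<Sum>g\<in>carrier G. R g p p * S (?inv g) q q) \<noteq> 0"
    by (metis (mono_tags, lifting) sum.neutral)
  then obtain q where q: "q \<in> J" and pq: "(\<Sum>g\<in>carrier G. R g p p * S (?inv g) q q) \<noteq> 0"
    by (metis (mono_tags, lifting) sum.neutral)
  \<comment> \<open>\<open>p\<close> and \<open>q\<close> are chosen so that the entry
    \<open>A p q\<close> is nonzero. \<open>B\<close> averages the transposed matrix unit, which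
    makes the trace of \<open>BA\<close> a multiple of this entry.\<close>
  define A where "A = (\<lambda>i j. \<Sum>g\<in>carrier G. R g i p * S (?inv g) q j)"
  define B where "B = (\<lambda>j i. \<Sum>g\<in>carrier G. S g j q * R (?inv g) p i)"
  have A: "(\<Sum>l\<in>I. R k i l * A l j) = (\<Sum>l\<in>J. A i l * S k l j)"
    if "k \<in> carrier G" "i \<in> I" "j \<in> J" for k i j
    unfolding A_def using averaged_intertwiner[OF Rrep Srep that(1) p q that(2,3)] .
  have B: "(\<Sum>l\<in>J. S k j l * B l i) = (\<Sum>l\<in>I. B j l * R k l i)"
    if "k \<in> carrier G" "i \<in> I" "j \<in> J" for k i j
    unfolding B_def using averaged_intertwiner[OF Srep Rrep that(1) q p that(3,2)] .
  define AB where "AB = (\<lambda>i i'. \<Sum>j\<in>J. A i j * B j i')"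
  define BA where "BA = (\<lambda>j j'. \<Sum>i\<in>I. B j i * A i j')"
  have "(\<Sum>l\<in>I. R k i l * AB l i') = (\<Sum>l\<in>I. AB i l * R k l i')"
    if k: "k \<in> carrier G" "i \<in> I" "i' \<in> I" for k i i'
  proof -
    have "(\<Sum>l\<in>I. R k i l * AB l i') = (\<Sum>j\<in>J. (\<Sum>l\<in>I. R k i l * A l j) * B j i')"
      unfolding AB_def by (simp add: sum_distrib_left sum_distrib_right mult.assoc sum.swap[of _ I])
    also have "\<dots> = (\<Sum>j\<in>J. (\<Sum>l\<in>J. A i l * S k l j) * B j i')"
      using k by (simp add: A)
    also have "\<dots> = (\<Sum>l\<in>J. A i l * (\<Sum>j\<in>J. S k l j * B j i'))"
      by (simp add: sum_distrib_left sum_distrib_right mult.assoc) (rule sum.swap)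
    also have "\<dots> = (\<Sum>l\<in>J. A i l * (\<Sum>j\<in>I. B l j * R k j i'))"
      using k by (simp add: B)
    also have "\<dots> = (\<Sum>l\<in>I. AB i l * R k l i')"
      unfolding AB_def by (simp add: sum_distrib_left sum_distrib_right mult.assoc sum.swap[of _ I])
    finally show ?thesis .
  qed
  then obtain c where c: "\<And>i j. i \<in> I \<Longrightarrow> j \<in> I \<Longrightarrow> AB i j = c * of_bool (i = j)"
    using R.schur[of AB] by blast
  have "(\<Sum>l\<in>J. S k i l * BA l i') = (\<Sum>l\<in>J. BA i l * S k l i')"
    if k: "k \<in> carrier G" "i \<in> J" "i' \<in> J" for k i i'
  proof -
    have "(\<Sum>l\<in>J. S k i l * BA l i') = (\<Sum>j\<in>I. (\<Sum>l\<in>J. S k i l * B l j) * A j i')"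
      unfolding BA_def by (simp add: sum_distrib_left sum_distrib_right mult.assoc sum.swap[of _ J])
    also have "\<dots> = (\<Sum>j\<in>I. (\<Sum>l\<in>I. B i l * R k l j) * A j i')"
      using k by (simp add: B)
    also have "\<dots> = (\<Sum>l\<in>I. B i l * (\<Sum>j\<in>I. R k l j * A j i'))"
      by (simp add: sum_distrib_left sum_distrib_right mult.assoc) (rule sum.swap)
    also have "\<dots> = (\<Sum>l\<in>I. B i l * (\<Sum>j\<in>J. A l j * S k j i'))"
      using k by (simp add: A)
    also have "\<dots> = (\<Sum>l\<in>J. BA i l * S k l i')"
      unfolding BA_def by (simp add: sum_distrib_left sum_distrib_right mult.assoc sum.swap[of _ J])
    finally show ?thesis .
  qed
  then obtain c' where c': "\<And>i j. i \<in> J \<Longrightarrow> j \<in> J \<Longrightarrow> BA i j = c' * of_bool (i = j)"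
    using S.schur[of BA] by blast
  have Apq: "A p q \<noteq> 0"
    using pq by (simp add: A_def)
  \<comment> \<open>Associativity, \<open>(AB) A = A (BA)\<close>, read off at a nonzero entry
    identifies the two scalars.\<close>
  have "c * A p q = (\<Sum>i\<in>I. AB p i * A i q)"
  proof -
    have "(\<Sum>i\<in>I. AB p i * A i q) = (\<Sum>i\<in>I. if p = i then c * A p q else 0)"
      by (intro sum.cong refl) (simp add: c p)
    then show ?thesis using p R.finite_index by simp
  qed
  also have "\<dots> = (\<Sum>j\<in>J. A p j * BA j q)"
    unfolding AB_def BA_def
    by (simp add: sum_distrib_left sum_distrib_right mult.assoc sum.swap[of _ I])
  also have "\<dots> = (\<Sum>j\<in>J. if j = q then c' * A p q else 0)"
    by (intro sum.cong refl) (simp add: c' q)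
  also have "\<dots> = c' * A p q"
    using q S.finite_index by simp
  finally have cc': "c = c'"
    using Apq by simp
  \<comment> \<open>Cyclicity of the trace: \<open>R k A B\<close> equals \<open>A S k B\<close>,
    which has the same trace as \<open>S k B A\<close>.\<close>
  have trace: "c * R.character k = c' * S.character k" if k: "k \<in> carrier G" for k
  proof -
    have "c * R.character k = (\<Sum>i\<in>I. \<Sum>l\<in>I. if l = i then c * R k i i else 0)"
      by (simp add: R.character_def sum_distrib_left R.finite_index)
    also have "\<dots> = (\<Sum>i\<in>I. \<Sum>l\<in>I. R k i l * AB l i)"
      by (intro sum.cong refl) (simp add: c)
    also have "\<dots> = (\<Sum>i\<in>I. \<Sum>j\<in>J. (\<Sum>l\<in>I. R k i l * A l j) * B j i)"
      unfolding AB_def by (simp add: sum_distrib_left sum_distrib_right mult.assoc sum.swap[of _ J])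
    also have "\<dots> = (\<Sum>i\<in>I. \<Sum>j\<in>J. (\<Sum>l\<in>J. A i l * S k l j) * B j i)"
      using k by (simp add: A)
    also have "\<dots> = (\<Sum>j\<in>J. \<Sum>l\<in>J. S k l j * BA j l)"
    proof -
      have "(\<Sum>i\<in>I. \<Sum>j\<in>J. (\<Sum>l\<in>J. A i l * S k l j) * B j i) =
            (\<Sum>j\<in>J. \<Sum>i\<in>I. \<Sum>l\<in>J. S k l j * (B j i * A i l))"
        by (subst sum.swap) (simp add: sum_distrib_left sum_distrib_right algebra_simps)
      also have "\<dots> = (\<Sum>j\<in>J. \<Sum>l\<in>J. \<Sum>i\<in>I. S k l j * (B j i * A i l))"
        by (intro sum.cong refl sum.swap)
      finally show ?thesis
        by (simp add: BA_def sum_distrib_left)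
    qed
    also have "\<dots> = (\<Sum>j\<in>J. \<Sum>l\<in>J. if j = l then c' * S k j j else 0)"
      by (intro sum.cong refl) (simp add: c')
    also have "\<dots> = c' * S.character k"
      by (simp add: S.character_def sum_distrib_left S.finite_index)
    finally show ?thesis .
  qed
  \<comment> \<open>Nonvanishing of the scalar: in the trace of \<open>BA\<close>, moving the
    inverse of \<open>g\<close> across \<open>A\<close> lets it cancel against \<open>g\<close>, and
    each group element leaves \<open>A p q\<close>.\<close>
  have "of_nat (card J) * c' = (\<Sum>j\<in>J. BA j j)"
    by (simp add: c')
  also have "\<dots> = (\<Sum>j\<in>J. \<Sum>i\<in>I. \<Sum>g\<in>carrier G. S g j q * R (?inv g) p i * A i j)"
    by (simp add: BA_def B_def sum_distrib_right)
  also have "\<dots> = (\<Sum>g\<in>carrier G. \<Sum>j\<in>J. S g j q * (\<Sum>i\<in>I. R (?inv g) p i * A i j))"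
    by (simp add: sum.swap[of _ "carrier G"] sum_distrib_left mult.assoc)
  also have "\<dots> = (\<Sum>g\<in>carrier G. \<Sum>j\<in>J. S g j q * (\<Sum>l\<in>J. A p l * S (?inv g) l j))"
    using p by (intro sum.cong refl) (simp add: A)
  also have "\<dots> = (\<Sum>g\<in>carrier G. \<Sum>l\<in>J. A p l * (\<Sum>j\<in>J. S (?inv g) l j * S g j q))"
  proof (rule sum.cong[OF refl])
    fix g
    have "(\<Sum>j\<in>J. S g j q * (\<Sum>l\<in>J. A p l * S (?inv g) l j)) =
          (\<Sum>j\<in>J. \<Sum>l\<in>J. A p l * (S (?inv g) l j * S g j q))"
      by (simp add: sum_distrib_left algebra_simps)
    also have "\<dots> = (\<Sum>l\<in>J. \<Sum>j\<in>J. A p l * (S (?inv g) l j * S g j q))"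
      by (rule sum.swap)
    finally show "(\<Sum>j\<in>J. S g j q * (\<Sum>l\<in>J. A p l * S (?inv g) l j)) =
                  (\<Sum>l\<in>J. A p l * (\<Sum>j\<in>J. S (?inv g) l j * S g j q))"
      by (simp add: sum_distrib_left)
  qed
  also have "\<dots> = (\<Sum>g\<in>carrier G. \<Sum>l\<in>J. if l = q then A p q else 0)"
    using q by (intro sum.cong refl) (simp add: S.rep_mult[symmetric] S.rep_one)
  also have "\<dots> = of_nat (card (carrier G)) * A p q"
    using q S.finite_index by simp
  finally have "c' \<noteq> 0"
    using Apq R.finite_carrier R.carrier_not_empty by auto
  then show ?thesis
    using trace[OF g] cc' by simp
qed

section \<open>Schur's lemma for irreducible matrix representations\<close>

lemma eigenspace_subspace:
  fixes M :: "complex mat"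
  assumes M: "M \<in> carrier_mat d d"
  shows "VectorSpace.subspace class_ring {v \<in> carrier_vec d. M *\<^sub>v v = c \<cdot>\<^sub>v v} (module_vec TYPE(complex) d)"
proof (intro subspace.intro vec_vs submodule.intro vec_module)
qed (use M in \<open>auto simp: module_vec_simps class_ring_simps mult_add_distrib_mat_vec
       smult_add_distrib_vec mult_mat_vec smult_smult_assoc mult.commute\<close>)

text \<open>Over the complex numbers and with \<open>d > 0\<close>, \<open>M\<close> has an
  eigenvalue. Its eigenspace is nonzero, and invariant because \<open>M\<close> commutes with every
  \<open>\<rho> g\<close>; irreducibility makes it the whole space.\<close>

lemma commutant_irreducible_representation:
  assumes irr: "irreducible_representation n d \<rho>"
    and carr: "\<And>g. g \<in> carrier (sym_group n) \<Longrightarrow> \<rho> g \<in> carrier_mat d d"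
    and M: "M \<in> carrier_mat d d"
    and comm: "\<And>g. g \<in> carrier (sym_group n) \<Longrightarrow> \<rho> g * M = M * \<rho> g"
  obtains c where "M = c \<cdot>\<^sub>m 1\<^sub>m d"
proof -
  have "d > 0"
    using irr by (simp add: irreducible_representation_def)
  then obtain c where "eigenvalue M c"
    using spectrum_non_empty[OF M] by (auto simp: spectrum_def)
  then obtain v where v: "v \<in> carrier_vec d" "v \<noteq> 0\<^sub>v d" "M *\<^sub>v v = c \<cdot>\<^sub>v v"
    using M by (auto simp: eigenvalue_def eigenvector_def)
  define W where "W = {v \<in> carrier_vec d. M *\<^sub>v v = c \<cdot>\<^sub>v v}"
  have "\<rho> g *\<^sub>v w \<in> W" if g: "g \<in> carrier (sym_group n)" and w: "w \<in> W" for g w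
  proof -
    have "M *\<^sub>v (\<rho> g *\<^sub>v w) = \<rho> g *\<^sub>v (M *\<^sub>v w)"
      using carr[OF g] M w comm[OF g] unfolding W_def
      by (metis (no_types, lifting) assoc_mult_mat_vec mem_Collect_eq)
    also have "\<dots> = c \<cdot>\<^sub>v (\<rho> g *\<^sub>v w)"
      using carr[OF g] w unfolding W_def by (simp add: mult_mat_vec)
    finally show ?thesis
      using carr[OF g] w unfolding W_def by simp
  qed
  moreover have "W \<noteq> {0\<^sub>v d}"
    using v unfolding W_def by blast
  ultimately have "W = carrier_vec d"
    using irr eigenspace_subspace[OF M, of c] unfolding irreducible_representation_def W_def by blast
  then have eigen: "M *\<^sub>v u = c \<cdot>\<^sub>v u" if "u \<in> carrier_vec d" for u
  proof -
    have "u \<in> W"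
      using \<open>W = carrier_vec d\<close> that by simp
    then show ?thesis
      using that by (simp add: W_def)
  qed
  have "M = c \<cdot>\<^sub>m 1\<^sub>m d"
  proof (intro eq_matI)
    fix i j
    assume "i < dim_row (c \<cdot>\<^sub>m 1\<^sub>m d)" "j < dim_col (c \<cdot>\<^sub>m 1\<^sub>m d)"
    then have "i < d" "j < d" by simp_all
    then show "M $$ (i, j) = (c \<cdot>\<^sub>m 1\<^sub>m d) $$ (i, j)"
      using arg_cong[OF eigen[of "unit_vec d j"], of "\<lambda>v. v $ i"] M by simp
  qed (use M in simp_all)
  then show thesis ..
qed

lemma irreducible_representation_schurian:
  assumes irr: "irreducible_representation n d \<rho>"
  shows "schurian_rep (sym_group n) {..<d} (\<lambda>g i j. \<rho> g $$ (i, j))"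
    and "\<And>g. g \<in> carrier (sym_group n) \<Longrightarrow> \<rho> g \<in> carrier_mat d d"
proof -
  interpret group "sym_group n" by (rule sym_group_is_group)
  have hom: "\<rho> \<in> hom (sym_group n) (units_of (ring_mat TYPE(complex) d ()))"
    using irr by (simp add: irreducible_representation_def matrix_representation_def)
  interpret semiring "ring_mat TYPE(complex) d ()" by (rule semiring_mat)
  have units: "group (units_of (ring_mat TYPE(complex) d ()))"
    by (rule units_group)
  show carr: "\<rho> g \<in> carrier_mat d d" if "g \<in> carrier (sym_group n)" for g
    using hom_in_carrier[OF hom that] by (auto simp: units_of_def Units_def ring_mat_simps)
  have mult: "\<rho> (g \<otimes>\<^bsub>sym_group n\<^esub> h) = \<rho> g * \<rho> h"
    if "g \<in> carrier (sym_group n)" "h \<in> carrier (sym_group n)" for g h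
    using hom_mult[OF hom that] by (simp add: units_of_def ring_mat_simps)
  have one: "\<rho> \<one>\<^bsub>sym_group n\<^esub> = 1\<^sub>m d"
    using hom_one[OF hom sym_group_is_group units] by (simp add: units_of_def ring_mat_simps)
  show "schurian_rep (sym_group n) {..<d} (\<lambda>g i j. \<rho> g $$ (i, j))"
  proof unfold_locales
    show "finite (carrier (sym_group n))"
      by (simp add: sym_group_def finite_permutations)
    show "finite {..<d}"
      by simp
    show "{..<d} \<noteq> {}"
      using irr by (auto simp: irreducible_representation_def)
    fix i j
    assume "i \<in> {..<d}" "j \<in> {..<d}"
    then show "\<rho> \<one>\<^bsub>sym_group n\<^esub> $$ (i, j) = of_bool (i = j)"
      by (simp add: one)
  next
    fix g h i j
    assume "g \<in> carrier (sym_group n)" "h \<in> carrier (sym_group n)" "i \<in> {..<d}" "j \<in> {..<d}"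
    then show "\<rho> (g \<otimes>\<^bsub>sym_group n\<^esub> h) $$ (i, j) = (\<Sum>k<d. \<rho> g $$ (i, k) * \<rho> h $$ (k, j))"
      using carr[of g] carr[of h] by (simp add: mult scalar_prod_def atLeast0LessThan)
  next
    fix A :: "nat \<Rightarrow> nat \<Rightarrow> complex"
    assume comm: "\<And>g i j. g \<in> carrier (sym_group n) \<Longrightarrow> i \<in> {..<d} \<Longrightarrow> j \<in> {..<d} \<Longrightarrow>
      (\<Sum>k<d. \<rho> g $$ (i, k) * A k j) = (\<Sum>k<d. A i k * \<rho> g $$ (k, j))"
    define M where "M = mat d d (\<lambda>(i, j). A i j)"
    have "\<rho> g * M = M * \<rho> g" if g: "g \<in> carrier (sym_group n)" for g
      using carr[OF g] comm[OF g]
      by (intro eq_matI) (auto simp: M_def scalar_prod_def atLeast0LessThan)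
    then obtain c where c: "M = c \<cdot>\<^sub>m 1\<^sub>m d"
      using commutant_irreducible_representation[OF irr carr, of M] unfolding M_def by auto
    have "A i j = c * of_bool (i = j)" if "i < d" "j < d" for i j
    proof -
      have "A i j = M $$ (i, j)"
        using that by (simp add: M_def)
      then show ?thesis
        using that by (simp add: c)
    qed
    then show "\<exists>c. \<forall>i\<in>{..<d}. \<forall>j\<in>{..<d}. A i j = c * of_bool (i = j)"
      by blast
  qed
qed

lemma irreducible_character_schurian:
  assumes "irreducible_character n f"
  obtains d R where "schurian_rep (sym_group n) {..<d::nat} R"
    "\<And>g. g \<in> carrier (sym_group n) \<Longrightarrow> f g = finite_matrix_rep.character {..<d} R g"
proof -
  from assms obtain d \<rho> where irr: "irreducible_representation n d \<rho>"
    and f: "\<forall>\<pi>\<in>carrier (sym_group n). f \<pi> = mat_trace (\<rho> \<pi>)"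
    unfolding irreducible_character_def by blast
  note rep = irreducible_representation_schurian[OF irr]
  interpret schurian_rep "sym_group n" "{..<d}" "\<lambda>g i j. \<rho> g $$ (i, j)"
    by (rule rep(1))
  have "f g = character g" if "g \<in> carrier (sym_group n)" for g
    using f rep(2)[OF that] that by (simp add: mat_trace_def character_def)
  then show thesis
    using that rep(1) by blast
qed

section \<open>Characters of the symmetric group and cycles\<close>

text \<open>The complements of \<open>X\<close> and of its image in the finite set \<open>S\<close>
  have the same size, so any bijection between them completes the map.\<close>

lemma injection_extends_to_permutation:
  assumes S: "finite S" "X \<subseteq> S" and \<phi>: "inj_on \<phi> X" "\<phi> ` X \<subseteq> S"
  obtains k where "k permutes S" "\<And>x. x \<in> X \<Longrightarrow> k x = \<phi> x"
proof -
  have "card (S - X) = card (S - \<phi> ` X)"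
    using assms by (simp add: card_Diff_subset finite_subset card_image)
  then obtain \<psi> where \<psi>: "bij_betw \<psi> (S - X) (S - \<phi> ` X)"
    using S finite_same_card_bij[of "S - X" "S - \<phi> ` X"] by auto
  define k where "k x = (if x \<in> X then \<phi> x else if x \<in> S then \<psi> x else x)" for x
  have "bij_betw k X (\<phi> ` X)"
    using \<phi>(1) by (simp add: k_def bij_betw_def cong: inj_on_cong)
  moreover have "bij_betw k (S - X) (S - \<phi> ` X)"
    using \<psi> by (rule bij_betw_cong[THEN iffD1, rotated]) (simp add: k_def)
  ultimately have "bij_betw k (X \<union> (S - X)) (\<phi> ` X \<union> (S - \<phi> ` X))"
    by (rule bij_betw_combine) auto
  moreover have "X \<union> (S - X) = S" "\<phi> ` X \<union> (S - \<phi> ` X) = S"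
    using S(2) \<phi>(2) by auto
  ultimately have "k permutes S"
    using S(2) by (intro bij_imp_permutes) (auto simp: k_def)
  then show thesis
    using that by (simp add: k_def)
qed

lemma permutation_between_lists:
  assumes S: "finite S" and xs: "distinct xs" "set xs \<subseteq> S" and ys: "distinct ys" "set ys \<subseteq> S"
    and len: "length xs = length ys"
  obtains k where "k permutes S" "map k xs = ys"
proof -
  define \<phi> where "\<phi> = the \<circ> map_of (zip xs ys)"
  have map: "map \<phi> xs = ys"
    using xs(1) len by (intro nth_equalityI) (simp_all add: \<phi>_def map_of_zip_nth)
  then have "inj_on \<phi> (set xs)" "\<phi> ` set xs \<subseteq> S"
    using xs(1) ys by (metis distinct_map, metis set_map)
  with S xs(2) obtain k where "k permutes S" "\<And>x. x \<in> set xs \<Longrightarrow> k x = \<phi> x"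
    by (rule injection_extends_to_permutation) blast
  then show thesis
    using that map by (metis map_eq_conv)
qed

text \<open>The lists are the cycles; a fixed point in \<open>S\<close> appears as a one-element
  list, because the lists must cover \<open>S\<close>. Prescribing the sequence of lengths rather
  than their multiset lets two permutations of equal type be matched position by position.\<close>

definition has_cycle_type :: "'a set \<Rightarrow> nat list \<Rightarrow> ('a \<Rightarrow> 'a) \<Rightarrow> bool" where
  "has_cycle_type S lam p \<longleftrightarrow> (\<exists>ls. map length ls = lam \<and> distinct (concat ls) \<and>
     set (concat ls) = S \<and> (\<forall>c\<in>set ls. \<forall>x\<in>set c. p x = cycle_of_list c x))"

text \<open>Disjointness turns the composition of cycles into a pointwise description: on the
  support of each cycle the other factors act trivially.\<close>

lemma cycle_decomp_lists:
  assumes "cycle_decomp S p"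
  shows "p permutes S \<and> (\<exists>ls. [] \<notin> set ls \<and> distinct (concat ls) \<and> set (concat ls) = S \<and>
           (\<forall>c\<in>set ls. \<forall>x\<in>set c. p x = cycle_of_list c x))"
  using assms
proof induction
  case empty
  show ?case
    by (auto intro!: exI[of _ "[]"])
next
  case (comp I p cs)
  then obtain ls where p: "p permutes I" and ls: "[] \<notin> set ls" "distinct (concat ls)"
    "set (concat ls) = I" "\<And>c x. c \<in> set ls \<Longrightarrow> x \<in> set c \<Longrightarrow> p x = cycle_of_list c x"
    by blast
  have perm: "cycle_of_list cs \<circ> p permutes set cs \<union> I"
    using permutes_compose[OF permutes_subset[OF p] permutes_subset[OF cycle_permutes]] by blast
  show ?case
  \<comment> \<open>The inductive definition admits the empty list as a cycle. It is dropped, since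
    it would become a part 0 of the partition.\<close>
  proof (cases "cs = []")
    case True
    then show ?thesis
      using p ls by auto
  next
    case False
    have "(cycle_of_list cs \<circ> p) x = cycle_of_list c x"
      if c: "c \<in> set (cs # ls)" "x \<in> set c" for c x
    proof (cases "c \<in> set ls")
      case True
      have "cycle_of_list c x \<in> set c"
        using cycle_permutes c(2) by (metis permutes_in_image)
      then have "cycle_of_list c x \<notin> set cs"
        using True ls(3) comp.hyps(3) by auto
      then show ?thesis
        using ls(4)[OF True c(2)] by (simp add: id_outside_supp)
    next
      case False
      then have "x \<in> set cs" "c = cs"
        using c by auto
      then have "p x = x"
        using comp.hyps(3) permutes_not_in[OF p] by blast
      then show ?thesis
        using \<open>c = cs\<close> by simp
    qed
    moreover have "distinct (concat (cs # ls))" "[] \<notin> set (cs # ls)" "set (concat (cs # ls)) = set cs \<union> I"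
      using ls comp.hyps False by (auto simp del: set_concat)
    ultimately show ?thesis
      using perm by blast
  qed
qed

lemma cycle_type_exists:
  assumes "p permutes {1..n}"
  obtains lam where "is_partition n lam" "has_cycle_type {1..n} lam p"
proof -
  obtain ls where ls: "[] \<notin> set ls" "distinct (concat ls)" "set (concat ls) = {1..n}"
    "\<forall>c\<in>set ls. \<forall>x\<in>set c. p x = cycle_of_list c x"
    using cycle_decomp_lists[OF cycle_decomposition[OF assms]] by auto
  define ks where "ks = rev (sort_key length ls)"
  have mset: "mset ks = mset ls"
    by (simp add: ks_def)
  then have set: "set ks = set ls"
    by (rule mset_eq_setD)
  have "mset (concat xs) = sum_mset (image_mset mset (mset xs))" for xs :: "nat list list"
    by (induction xs) auto
  then have "mset (concat ks) = mset (concat ls)"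
    using mset by simp
  then have concat: "distinct (concat ks)" "set (concat ks) = {1..n}"
    using ls(2,3) by (metis mset_eq_imp_distinct_iff, metis mset_eq_setD)
  have "sum_list (map length ks) = n"
    using distinct_card[OF concat(1)] concat(2) by (simp add: length_concat)
  moreover have "sorted_wrt (\<ge>) (map length ks)"
    by (simp add: ks_def rev_map[symmetric] sorted_wrt_rev)
  moreover have "0 \<notin> set (map length ks)"
    using ls(1) set by auto
  ultimately have "is_partition n (map length ks)"
    by (simp add: is_partition_def)
  moreover have "has_cycle_type {1..n} (map length ks) p"
    unfolding has_cycle_type_def using concat ls(4) set by blast
  ultimately show thesis ..
qed

text \<open>Writing the cycles of \<open>p\<close> above those of \<open>q\<close> gives a
  relabelling \<open>k\<close>, and conjugating a cycle by \<open>k\<close> relabels its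
  entries.\<close>

lemma conjugate_if_same_cycle_type:
  assumes p: "p permutes S" and q: "q permutes S" and S: "finite S"
    and "has_cycle_type S lam p" "has_cycle_type S lam q"
  obtains k where "k permutes S" "q = k \<circ> p \<circ> inv' k"
proof -
  obtain ls where ls: "map length ls = lam" "distinct (concat ls)"
    "set (concat ls) = S" "\<And>c x. c \<in> set ls \<Longrightarrow> x \<in> set c \<Longrightarrow> p x = cycle_of_list c x"
    using assms(4) unfolding has_cycle_type_def by blast
  obtain ks where ks: "map length ks = lam" "distinct (concat ks)"
    "set (concat ks) = S" "\<And>c x. c \<in> set ks \<Longrightarrow> x \<in> set c \<Longrightarrow> q x = cycle_of_list c x"
    using assms(5) unfolding has_cycle_type_def by blast
  have "length (concat ls) = length (concat ks)"
    using ls(1) ks(1) by (simp add: length_concat)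
  then obtain k where k: "k permutes S" "map k (concat ls) = concat ks"
    using permutation_between_lists[OF S ls(2) _ ks(2)] ls(3) ks(3) by blast
  have "concat (map (map k) ls) = concat ks"
    using k(2) by (simp add: map_concat)
  moreover have len: "length (map (map k) ls) = length ks"
    using arg_cong[OF trans[OF ls(1) ks(1)[symmetric]], of length] by simp
  moreover have "length (ls ! i) = length (ks ! i)" if "i < length ls" for i
    using arg_cong[OF trans[OF ls(1) ks(1)[symmetric]], of "\<lambda>l. l ! i"] that len by simp
  then have "\<forall>(x, y)\<in>set (zip (map (map k) ls) ks). length x = length y"
    using len by (auto simp: set_zip)
  \<comment> \<open>Equal concatenations cut at the same places have equal pieces, so
    \<open>k\<close> carries the i-th cycle of \<open>p\<close> to the i-th cycle of
    \<open>q\<close>.\<close>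
  ultimately have ks_eq: "ks = map (map k) ls"
    using concat_injective by metis
  have comm: "q (k x) = k (p x)" for x
  proof (cases "x \<in> S")
    case True
    then obtain c where c: "c \<in> set ls" "x \<in> set c"
      using ls(3) by auto
    then have "distinct c"
      using ls(2) by (simp add: distinct_concat_iff)
    have "q (k x) = cycle_of_list (map k c) (k x)"
      using c ks(4) ks_eq by auto
    also have "\<dots> = (k \<circ> cycle_of_list c \<circ> inv' k) (k x)"
      using conjugation_of_cycle[OF \<open>distinct c\<close> permutes_bij[OF k(1)]] by simp
    also have "\<dots> = k (p x)"
      using ls(4)[OF c] permutes_inverses(2)[OF k(1)] by simp
    finally show ?thesis .
  next
    case False
    then show ?thesis
      using p q k(1) by (simp add: permutes_not_in)
  qed
  have "q = k \<circ> p \<circ> inv' k"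
  proof
    show "q x = (k \<circ> p \<circ> inv' k) x" for x
      using comm[of "inv' k x"] permutes_inverses(1)[OF k(1)] by simp
  qed
  with k(1) show thesis ..
qed

locale sym_schurian_rep = schurian_rep "sym_group n" for n
begin

lemma character_conj:
  assumes "g permutes {1..n}" "k permutes {1..n}"
  shows "character (k \<circ> g \<circ> inv' k) = character g"
  using character_conjugate[of g k] assms
  by (simp add: sym_group_carrier sym_group_mult sym_group_inv_equality)

lemma character_same_cycle_type:
  assumes "p permutes {1..n}" "q permutes {1..n}"
    and "has_cycle_type {1..n} lam p" "has_cycle_type {1..n} lam q"
  shows "character p = character q"
  using conjugate_if_same_cycle_type[OF assms(1,2) _ assms(3,4)] character_conj[OF assms(1)]
  by (metis finite_atLeastAtMost)

lemma character_product_sym: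
  assumes "g permutes {1..n}" "g' permutes {1..n}"
  shows "of_nat (card I) * (\<Sum>u | u permutes {1..n}. character (u \<circ> g \<circ> inv' u \<circ> g')) =
         of_nat (card {u. u permutes {1..n}}) * character g * character g'"
proof -
  have carrier: "carrier (sym_group n) = {u. u permutes {1..n}}"
    by (simp add: sym_group_def)
  have "(\<Sum>u\<in>carrier (sym_group n). character (u \<circ> g \<circ> inv' u \<circ> g')) =
        (\<Sum>u\<in>carrier (sym_group n). character (u \<otimes>\<^bsub>sym_group n\<^esub> g \<otimes>\<^bsub>sym_group n\<^esub> inv\<^bsub>sym_group n\<^esub> u \<otimes>\<^bsub>sym_group n\<^esub> g'))"
    by (intro sum.cong refl) (simp add: sym_group_mult sym_group_inv_equality)
  then show ?thesis
    using character_product[of g g'] assms by (simp add: carrier)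
qed

end

text \<open>For \<open>k = 1\<close> this is the identity, so the queries include the
  degree.\<close>

definition standard_cycle :: "nat \<Rightarrow> nat \<Rightarrow> nat" where
  "standard_cycle k = cycle_of_list [1..<Suc k]"

lemma standard_cycle_permutes: "k \<le> n \<Longrightarrow> standard_cycle k permutes {1..n}"
  unfolding standard_cycle_def by (rule permutes_subset[OF cycle_permutes]) auto

text \<open>\<open>support g x\<close> lists the orbit of \<open>x\<close> in cyclic order, so
  \<open>g\<close> acts on it as a cycle and preserves its complement. The pointwise formula for
  \<open>g'\<close> makes the disjointness of the two supports visible.\<close>

lemma split_off_cycle:
  assumes g: "g permutes S" and S: "finite S" and x: "g x \<noteq> x"
  obtains c g' where "distinct c" "set c \<subseteq> {y. g y \<noteq> y}" "x \<in> set c" "g' permutes S"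
    "\<And>y. g' y = (if y \<in> set c then y else g y)" "g = cycle_of_list c \<circ> g'"
proof -
  have perm: "permutation g"
    using g S permutation_permutes by blast
  define c where "c = support g x"
  define g' where "g' = (\<lambda>y. if y \<in> S - set c then g y else y)"
  have c: "distinct c"
    unfolding c_def by (rule cycle_of_permutation[OF perm])
  have x_in: "x \<in> set c"
    using least_power_of_permutation(2)[OF perm, of x] unfolding c_def by force
  have moved: "set c \<subseteq> {y. g y \<noteq> y}"
    using support_coverture[OF perm] x unfolding c_def by blast
  have g': "g' permutes S - set c"
    unfolding g'_def c_def by (rule semidecomposition[OF g S])
  have g'_eq: "g' y = (if y \<in> set c then y else g y)" for y
    using permutes_not_in[OF g, of y] by (auto simp: g'_def)
  have "g y = (cycle_of_list c \<circ> g') y" for y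
  proof (cases "y \<in> set c")
    case True
    then show ?thesis
      using cycle_restrict[OF perm, of y x] by (simp add: g'_eq c_def)
  next
    case False
    then have "g' y \<notin> set c"
      using permutes_in_image[OF g', of y] permutes_not_in[OF g', of y] by (cases "y \<in> S") auto
    then show ?thesis
      using False by (simp add: id_outside_supp g'_eq)
  qed
  moreover have "g' permutes S"
    using g' by (rule permutes_subset) simp
  ultimately show thesis
    using that c moved x_in g'_eq by blast
qed

text \<open>The last assumption says that the image of \<open>C\<close> under \<open>u\<close> also
  avoids the support of \<open>g'\<close>. Hence the map that is \<open>u\<close> on
  \<open>C\<close> and the identity on that support is injective; any permutation \<open>k\<close>
  extending it moves \<open>h\<close> to its conjugate by \<open>u\<close> and leaves
  \<open>g'\<close> alone.\<close>

lemma conjugate_of_disjoint_product: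
  assumes h: "h permutes S" and g': "g' permutes S" and u: "u permutes S" and S: "finite S"
    and hC: "\<And>y. y \<notin> C \<Longrightarrow> h y = y" and C: "C \<subseteq> S"
    and fixC: "\<And>y. y \<in> C \<Longrightarrow> g' y = y" and fixC_u: "\<And>y. y \<in> C \<Longrightarrow> g' (u y) = u y"
  obtains k where "k permutes S" "u \<circ> h \<circ> inv' u \<circ> g' = k \<circ> (h \<circ> g') \<circ> inv' k"
proof -
  define X where "X = {y. g' y \<noteq> y}"
  have disj: "C \<inter> X = {}" "u ` C \<inter> X = {}"
    using fixC fixC_u by (auto simp: X_def)
  have hclosed: "h y \<in> C" if "y \<in> C" for y
    using that hC permutes_inj[OF h] by (metis injD)
  have g'X: "g' y \<in> X" if "y \<in> X" for y
    using that permutes_inj[OF g'] by (simp add: X_def inj_eq)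
  have XS: "X \<subseteq> S"
    using permutes_not_in[OF g'] by (auto simp: X_def)
  define \<phi> where "\<phi> y = (if y \<in> C then u y else y)" for y
  have "inj_on \<phi> (C \<union> X)"
  proof (rule inj_onI)
    fix y z
    assume "y \<in> C \<union> X" "z \<in> C \<union> X" "\<phi> y = \<phi> z"
    then show "y = z"
      using disj permutes_inj[OF u] by (auto simp: \<phi>_def inj_eq split: if_splits)
  qed
  moreover have "\<phi> ` (C \<union> X) \<subseteq> S"
    using C XS u by (auto simp: \<phi>_def permutes_in_image)
  ultimately obtain k where k: "k permutes S" and k\<phi>: "\<And>y. y \<in> C \<union> X \<Longrightarrow> k y = \<phi> y"
    using injection_extends_to_permutation[OF S, of "C \<union> X" \<phi>] C XS by blast
  have kC: "k y = u y" if "y \<in> C" for y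
    using that k\<phi> by (simp add: \<phi>_def)
  have kX: "k y = y" if "y \<in> X" for y
    using that k\<phi>[of y] disj by (auto simp: \<phi>_def)
  have fixed: "u (h (inv' u z)) = z" if "z \<notin> u ` C" for z
  proof -
    have "inv' u z \<notin> C"
      using that permutes_inverses(1)[OF u, of z] by (metis imageI)
    then show ?thesis
      using hC permutes_inverses(1)[OF u] by simp
  qed
  \<comment> \<open>The conjugacy as an intertwining relation, checked on \<open>C\<close>, on
    \<open>X\<close> and elsewhere; the remaining points are sent by \<open>k\<close> outside both
    \<open>X\<close> and the image of \<open>C\<close> under \<open>u\<close>.\<close>
  have comm: "u (h (inv' u (g' (k y)))) = k (h (g' y))" for y
  proof -
    consider "y \<in> C" | "y \<in> X" | "y \<notin> C" "y \<notin> X" by blast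
    then show ?thesis
    proof cases
      case 1
      then show ?thesis
        using fixC fixC_u kC hclosed permutes_inverses(2)[OF u] by simp
    next
      case 2
      then have "g' y \<in> X" by (rule g'X)
      then have "g' y \<notin> u ` C" "g' y \<notin> C"
        using disj by auto
      then show ?thesis
        using 2 kX fixed hC \<open>g' y \<in> X\<close> by simp
    next
      case 3
      have "k y \<notin> u ` C"
        using 3 kC permutes_inj[OF k] by (metis imageE injD)
      moreover have "k y \<notin> X"
        using 3 kX permutes_inj[OF k] by (metis injD)
      ultimately show ?thesis
        using 3 hC fixed by (simp add: X_def)
    qed
  qed
  have "u \<circ> h \<circ> inv' u \<circ> g' = k \<circ> (h \<circ> g') \<circ> inv' k"
  proof
    show "(u \<circ> h \<circ> inv' u \<circ> g') y = (k \<circ> (h \<circ> g') \<circ> inv' k) y" for y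
      using comm[of "inv' k y"] permutes_inverses(1)[OF k] by simp
  qed
  with k show thesis ..
qed

text \<open>The support of the product lies in the union of the two supports, and these share the
  point \<open>u z\<close>.\<close>

lemma card_support_overlapping_product:
  assumes u: "u permutes S" and C: "finite C" "\<And>y. y \<notin> C \<Longrightarrow> h y = y"
    and X: "finite {y. g' y \<noteq> y}"
    and z: "z \<in> C" "g' (u z) \<noteq> u z"
  shows "card {y. (u \<circ> h \<circ> inv' u \<circ> g') y \<noteq> y} < card C + card {y. g' y \<noteq> y}"
proof -
  let ?X = "{y. g' y \<noteq> y}"
  have "{y. (u \<circ> h \<circ> inv' u \<circ> g') y \<noteq> y} \<subseteq> u ` C \<union> ?X"
  proof
    fix y
    assume y: "y \<in> {y. (u \<circ> h \<circ> inv' u \<circ> g') y \<noteq> y}"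
    show "y \<in> u ` C \<union> ?X"
    proof (rule ccontr)
      assume n: "y \<notin> u ` C \<union> ?X"
      then have "inv' u y \<notin> C"
        using permutes_inverses(1)[OF u, of y] by (metis UnI1 imageI)
      then show False
        using y n C(2) permutes_inverses(1)[OF u] by simp
    qed
  qed
  then have "card {y. (u \<circ> h \<circ> inv' u \<circ> g') y \<noteq> y} \<le> card (u ` C \<union> ?X)"
    using C(1) X by (intro card_mono) auto
  moreover have "u ` C \<inter> ?X \<noteq> {}"
    using z by blast
  then have "card (u ` C \<inter> ?X) > 0"
    using C(1) by (simp add: card_gt_0_iff)
  moreover have "card (u ` C \<union> ?X) + card (u ` C \<inter> ?X) = card (u ` C) + card ?X"
    using card_Un_Int[of "u ` C" ?X] C(1) X by simp
  moreover have "card (u ` C) \<le> card C"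
    using C(1) by (rule card_image_le)
  ultimately show ?thesis
    by linarith
qed

text \<open>
  Induction on the size of the support. If \<open>g = c g'\<close> splits off a cycle \<open>c\<close>, then \<open>\<chi>(c) \<chi>(g')\<close> is
  up to a constant the sum of \<open>\<chi>(u c u\<^sup>-\<^sup>1 g')\<close> over all \<open>u\<close>. The summands in which
  the supports of \<open>u c u\<^sup>-\<^sup>1\<close> and \<open>g'\<close> are disjoint equal \<open>\<chi>(g)\<close>, the others have smaller support.
\<close>

lemma characters_determined_by_cycles:
  assumes "sym_schurian_rep I R n" "sym_schurian_rep J Q n" and n: "n > 0"
    and cycles: "\<And>k. 1 \<le> k \<Longrightarrow> k \<le> n \<Longrightarrow>
      finite_matrix_rep.character I R (standard_cycle k) = finite_matrix_rep.character J Q (standard_cycle k)"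
    and g: "g permutes {1..n}"
  shows "finite_matrix_rep.character I R g = finite_matrix_rep.character J Q g"
proof -
  interpret R: sym_schurian_rep I R n by fact
  interpret Q: sym_schurian_rep J Q n by fact
  have id: "standard_cycle (Suc 0) = id"
    by (simp add: standard_cycle_def)
  have deg: "of_nat (card I) = (of_nat (card J) :: complex)"
    using cycles[of "Suc 0"] n R.character_one Q.character_one by (simp add: id sym_group_one)
  from g show ?thesis
  proof (induction "card {y. g y \<noteq> y}" arbitrary: g rule: less_induct)
    case less
    note g = less.prems
    have supp_finite: "finite {y. p y \<noteq> y}" if "p permutes {1..n}" for p
      by (rule finite_subset[OF _ finite_atLeastAtMost[of 1 n]]) (use permutes_not_in[OF that] in blast)
    show ?case
    proof (cases "g = id")
      case True
      then show ?thesis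
        using cycles[of "Suc 0"] n by (simp add: id)
    next
      case False
      then obtain x where x: "g x \<noteq> x" by (auto simp: fun_eq_iff)
      obtain c g' where c: "distinct c" "set c \<subseteq> {y. g y \<noteq> y}" "x \<in> set c"
        and g': "g' permutes {1..n}" and g'_eq: "\<And>y. g' y = (if y \<in> set c then y else g y)"
        and g_eq: "g = cycle_of_list c \<circ> g'"
        by (rule split_off_cycle[OF g finite_atLeastAtMost x]) (rule that)
      define h where "h = cycle_of_list c"
      have cS: "set c \<subseteq> {1..n}"
        using c(2) permutes_not_in[OF g] by blast
      have h: "h permutes {1..n}"
        unfolding h_def using cycle_permutes cS by (rule permutes_subset)
      have h_out: "h y = y" if "y \<notin> set c" for y
        using that by (simp add: h_def id_outside_supp)
      show ?thesis
      proof (cases "g' = id")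
        case True
        \<comment> \<open>Base case: a single cycle is conjugate to the standard cycle of its
          length.\<close>
        have len: "length c \<le> n"
          using card_mono[OF _ cS] distinct_card[OF c(1)] by simp
        have target: "distinct [1..<Suc (length c)]" "set [1..<Suc (length c)] \<subseteq> {1..n}"
          "length c = length [1..<Suc (length c)]"
          using len by (simp_all del: upt_Suc add: atLeastLessThanSuc_atLeastAtMost)
        obtain k where k: "k permutes {1..n}" "map k c = [1..<Suc (length c)]"
          by (rule permutation_between_lists[OF finite_atLeastAtMost c(1) cS target]) (rule that)
        have "standard_cycle (length c) = k \<circ> g \<circ> inv' k"
          using conjugation_of_cycle[OF c(1) permutes_bij[OF k(1)]] True
          by (simp add: standard_cycle_def k(2) g_eq)
        then show ?thesis
          using cycles[of "length c"] len c(3) R.character_conj[OF g k(1)] Q.character_conj[OF g k(1)]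
          by (cases c) auto
      next
        case False
        then obtain y where y: "g' y \<noteq> y" by (auto simp: fun_eq_iff)
        define prd where "prd u = u \<circ> h \<circ> inv' u \<circ> g'" for u
        have prd_perm: "prd u permutes {1..n}" if "u permutes {1..n}" for u
          unfolding prd_def using that h g' by (intro permutes_compose permutes_inv)
        \<comment> \<open>\<open>T\<close> collects the \<open>u\<close> that keep the supports of
          the two factors disjoint.\<close>
        define T where "T = {u. u permutes {1..n} \<and> (\<forall>z\<in>set c. g' (u z) = u z)}"
        have disj: "set c \<inter> {y. g' y \<noteq> y} = {}"
          by (auto simp: g'_eq)
        have union: "set c \<union> {y. g' y \<noteq> y} \<subseteq> {y. g y \<noteq> y}"
          using c(2) by (auto simp: g'_eq)
        have card: "card (set c) + card {y. g' y \<noteq> y} \<le> card {y. g y \<noteq> y}"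
          using card_mono[OF supp_finite[OF g] union] disj
          by (simp add: card_Un_disjoint supp_finite[OF g'])
        \<comment> \<open>Neither support is empty, so each factor moves fewer points than
          \<open>g\<close>.\<close>
        have "card {y. g' y \<noteq> y} > 0" "card (set c) > 0"
          using y c(3) supp_finite[OF g'] by (auto simp: card_gt_0_iff)
        moreover have "card {y. h y \<noteq> y} \<le> card (set c)"
          using h_out by (intro card_mono) auto
        ultimately have IH_factors: "R.character h = Q.character h" "R.character g' = Q.character g'"
          using card less.hyps[OF _ h] less.hyps[OF _ g'] by auto
        have in_T: "R.character (prd u) = R.character g \<and> Q.character (prd u) = Q.character g"
          if "u \<in> T" for u
        proof -
          have u: "u permutes {1..n}" "\<And>z. z \<in> set c \<Longrightarrow> g' (u z) = u z"
            using that by (auto simp: T_def)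
          obtain k where "k permutes {1..n}" "prd u = k \<circ> g \<circ> inv' k"
            unfolding prd_def g_eq h_def[symmetric]
            by (rule conjugate_of_disjoint_product[OF h g' u(1) finite_atLeastAtMost, of "set c"])
               (use h_out cS u(2) g'_eq in auto)
          then show ?thesis
            using R.character_conj[OF g] Q.character_conj[OF g] by simp
        qed
        have not_in_T: "R.character (prd u) = Q.character (prd u)"
          if not_T: "u \<in> {u. u permutes {1..n}} - T" for u
        proof -
          obtain z where u: "u permutes {1..n}" and z: "z \<in> set c" "g' (u z) \<noteq> u z"
            using not_T unfolding T_def by blast
          have "card {y. prd u y \<noteq> y} < card {y. g y \<noteq> y}"
            using card_support_overlapping_product[OF u _ h_out supp_finite[OF g'] z] card
            unfolding prd_def by simp
          then show ?thesis
            using less.hyps prd_perm[OF u] by blast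
        qed
        have finT: "finite {u. u permutes {1..n}}" "T \<subseteq> {u. u permutes {1..n}}"
          by (auto simp: finite_permutations T_def)
        have split: "(\<Sum>u | u permutes {1..n}. F (prd u)) =
            (\<Sum>u\<in>{u. u permutes {1..n}} - T. F (prd u)) + (\<Sum>u\<in>T. F (prd u))" for F :: "_ \<Rightarrow> complex"
          using finT by (rule sum.subset_diff[rotated])
        \<comment> \<open>Both product formulas have the same right-hand side, by
          \<open>IH_factors\<close>; \<open>deg\<close> allows the same factor on the left. The
          terms outside \<open>T\<close> then cancel.\<close>
        have "of_nat (card I) * (\<Sum>u | u permutes {1..n}. R.character (prd u)) =
              of_nat (card I) * (\<Sum>u | u permutes {1..n}. Q.character (prd u))"
          using R.character_product_sym[OF h g'] Q.character_product_sym[OF h g'] deg IH_factors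
          by (simp add: prd_def)
        then have "(\<Sum>u | u permutes {1..n}. R.character (prd u)) =
                   (\<Sum>u | u permutes {1..n}. Q.character (prd u))"
          using R.card_index_nonzero by simp
        moreover have "(\<Sum>u\<in>{u. u permutes {1..n}} - T. R.character (prd u)) =
                       (\<Sum>u\<in>{u. u permutes {1..n}} - T. Q.character (prd u))"
          by (intro sum.cong refl not_in_T)
        ultimately have "(\<Sum>u\<in>T. R.character (prd u)) = (\<Sum>u\<in>T. Q.character (prd u))"
          unfolding split by simp
        then have "of_nat (card T) * R.character g = of_nat (card T) * Q.character g"
          using in_T by simp
        \<comment> \<open>The identity itself keeps the supports disjoint, so the coefficient of the
          value at \<open>g\<close> is nonzero.\<close>
        moreover have "id \<in> T"
          by (auto simp: T_def permutes_id g'_eq)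
        then have "card T \<noteq> 0"
          using finite_subset[OF finT(2,1)] by (metis card_0_eq empty_iff)
        ultimately show ?thesis
          by simp
      qed
    qed
  qed
qed

section \<open>Partitions and Young diagrams\<close>

lemma young_diagram_Sigma: "young_diagram lam = (SIGMA i:{..<length lam}. {..<lam ! i})"
  by (auto simp: young_diagram_def)

lemma finite_young_diagram [simp]: "finite (young_diagram lam)"
  by (simp add: young_diagram_Sigma)

lemma card_young_diagram_rows: "card {c \<in> young_diagram lam. fst c < k} = sum_list (take k lam)"
proof -
  have "{c \<in> young_diagram lam. fst c < k} = (SIGMA i:{..<min k (length lam)}. {..<lam ! i})"
    by (auto simp: young_diagram_def)
  then show ?thesis
    by (simp add: sum_list_sum_nth atLeast0LessThan min.commute)
qed

lemma card_young_diagram: "card (young_diagram lam) = sum_list lam"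
proof -
  have "{c \<in> young_diagram lam. fst c < length lam} = young_diagram lam"
    by (auto simp: young_diagram_def)
  then show ?thesis
    using card_young_diagram_rows[of lam "length lam"] by simp
qed

lemma young_diagram_up_closed:
  assumes "is_partition n lam" "(i, j) \<in> young_diagram lam" "i' \<le> i"
  shows "(i', j) \<in> young_diagram lam"
proof -
  have "lam ! i \<le> lam ! i'"
    using assms by (cases "i' = i") (auto simp: is_partition_def young_diagram_def sorted_wrt_iff_nth_less)
  then show ?thesis
    using assms by (auto simp: young_diagram_def)
qed

lemma downward_closed_eq_lessThan:
  fixes A :: "nat set"
  assumes "finite A" "\<And>a b. a \<in> A \<Longrightarrow> b \<le> a \<Longrightarrow> b \<in> A"
  shows "A = {..<card A}"
proof (rule card_subset_eq)
  show "A \<subseteq> {..<card A}"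
  proof
    fix a
    assume "a \<in> A"
    then have "{..a} \<subseteq> A"
      using assms(2) by blast
    then show "a \<in> {..<card A}"
      using card_mono[OF assms(1), of "{..a}"] by simp
  qed
qed simp_all

text \<open>Antisymmetry of the dominance order, which compares prefix sums. Since the parts are
  positive, the prefix sums stop growing exactly at the end of the list, so they also determine the
  length.\<close>

lemma partition_eqI:
  assumes lam: "is_partition n lam" and mu: "is_partition n mu"
    and take: "\<And>k. sum_list (take k lam) = sum_list (take k mu)"
  shows "lam = mu"
proof -
  have step: "sum_list (take (Suc k) xs) = sum_list (take k xs) + xs ! k" if "k < length xs"
    for k and xs :: "nat list"
    using that by (simp add: take_Suc_conv_app_nth)
  have not_less: "\<not> length xs < length ys"
    if "is_partition n xs" "is_partition n ys" "\<And>k. sum_list (take k xs) = sum_list (take k ys)" for xs ys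
  proof
    assume less: "length xs < length ys"
    have "ys ! length xs > 0"
      using that(2) nth_mem[OF less] unfolding is_partition_def by (metis neq0_conv)
    then show False
      using that(3)[of "length xs"] that(3)[of "Suc (length xs)"] step[OF less] by simp
  qed
  have len: "length lam = length mu"
    using not_less[OF lam mu take] not_less[OF mu lam take[symmetric]] by simp
  show ?thesis
  proof (rule nth_equalityI[OF len])
    fix i
    assume "i < length lam"
    then show "lam ! i = mu ! i"
      using step[of i lam] step[of i mu] take[of i] take[of "Suc i"] len by simp
  qed
qed

lemma finite_partitions: "finite {lam. is_partition n lam}"
proof (rule finite_subset)
  show "{lam. is_partition n lam} \<subseteq> {xs. set xs \<subseteq> {..n} \<and> length xs \<le> n}"
  proof
    fix lam
    assume "lam \<in> {lam. is_partition n lam}"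
    then have pos: "0 \<notin> set lam" and sum: "sum_list lam = n"
      by (auto simp: is_partition_def)
    have "length lam \<le> sum_list lam"
      using pos by (induction lam) auto
    moreover have "x \<le> sum_list lam" if "x \<in> set lam" for x
      using that by (rule member_le_sum_list) simp
    ultimately show "lam \<in> {xs. set xs \<subseteq> {..n} \<and> length xs \<le> n}"
      using sum by auto
  qed
  show "finite {xs. set xs \<subseteq> {..n} \<and> length xs \<le> n}"
    by (rule finite_lists_length_le) simp
qed

text \<open>
  A column of height \<open>h\<close> meets the first \<open>k\<close> rows at most \<open>min k h\<close> times; summing over the
  columns gives both claims.
\<close>

lemma column_injective_rows:
  fixes row col :: "'a \<Rightarrow> nat"
  assumes lam: "is_partition n lam" and X: "finite X"
    and col: "\<And>j. card {x \<in> X. col x = j} = card {i. (i, j) \<in> young_diagram lam}"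
    and inj: "inj_on (\<lambda>x. (row x, col x)) X"
  shows card_rows_le: "card {x \<in> X. row x < k} \<le> sum_list (take k lam)"
    and "(\<And>k. card {x \<in> X. row x < k} = sum_list (take k lam)) \<Longrightarrow> x \<in> X \<Longrightarrow>
           (row x, col x) \<in> young_diagram lam"
proof -
  \<comment> \<open>\<open>h j\<close> is the height of column \<open>j\<close>, a part of the
    conjugate partition. \<open>J\<close> contains every column met by \<open>X\<close> or by the
    diagram, so that both counts can be grouped over one finite set.\<close>
  define h where "h j = card {i. (i, j) \<in> young_diagram lam}" for j
  define J where "J = col ` X \<union> snd ` young_diagram lam"
  have J: "finite J" "col ` X \<subseteq> J" "snd ` young_diagram lam \<subseteq> J"
    using X by (auto simp: J_def)
  have fin: "finite {i. (i, j) \<in> young_diagram lam}" for j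
    by (rule finite_subset[of _ "fst ` young_diagram lam"]) force+
  have column: "{i. (i, j) \<in> young_diagram lam} = {..<h j}" for j
    unfolding h_def using young_diagram_up_closed[OF lam] fin
    by (intro downward_closed_eq_lessThan) auto
  have cell: "(i, j) \<in> young_diagram lam \<longleftrightarrow> i < h j" for i j
    using column[of j] by blast
  have rows: "sum_list (take k lam) = (\<Sum>j\<in>J. min k (h j))" for k
  proof -
    have "sum_list (take k lam) = card {c \<in> young_diagram lam. fst c < k}"
      by (simp add: card_young_diagram_rows)
    also have "\<dots> = (\<Sum>j\<in>J. card {c \<in> {c \<in> young_diagram lam. fst c < k}. snd c = j})"
    proof -
      have "snd ` {c \<in> young_diagram lam. fst c < k} \<subseteq> J"
        using J(3) by auto
      then show ?thesis
        using J(1) sum.group[of "{c \<in> young_diagram lam. fst c < k}" J snd "\<lambda>_. 1::nat"] by simp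
    qed
    also have "\<dots> = (\<Sum>j\<in>J. min k (h j))"
    proof (rule sum.cong[OF refl])
      fix j
      have "{c \<in> {c \<in> young_diagram lam. fst c < k}. snd c = j} = (\<lambda>i. (i, j)) ` {..<min k (h j)}"
        using column[of j] by force
      then show "card {c \<in> {c \<in> young_diagram lam. fst c < k}. snd c = j} = min k (h j)"
        by (simp add: card_image inj_on_def)
    qed
    finally show ?thesis .
  qed
  define r where "r k j = card {x \<in> {x \<in> X. row x < k}. col x = j}" for k j
  have r: "card {x \<in> X. row x < k} = (\<Sum>j\<in>J. r k j)" for k
  proof -
    have "col ` {x \<in> X. row x < k} \<subseteq> J"
      using J(2) by auto
    then show ?thesis
      using X J(1) sum.group[of "{x \<in> X. row x < k}" J col "\<lambda>_. 1::nat"] by (simp add: r_def)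
  qed
  have r_le: "r k j \<le> min k (h j)" for k j
  proof -
    have "r k j \<le> card {x \<in> X. col x = j}"
      unfolding r_def using X by (intro card_mono) auto
    moreover have "r k j \<le> card {..<k}"
      unfolding r_def
      by (rule card_inj_on_le[of row]) (use inj in \<open>auto simp: inj_on_def\<close>)
    ultimately show ?thesis
      using col by (simp add: h_def)
  qed
  show "card {x \<in> X. row x < k} \<le> sum_list (take k lam)"
    unfolding r rows by (rule sum_mono) (rule r_le)
  assume eq: "\<And>k. card {x \<in> X. row x < k} = sum_list (take k lam)" and x: "x \<in> X"
  show "(row x, col x) \<in> young_diagram lam"
  \<comment> \<open>Take \<open>k = h (col x)\<close>. If \<open>x\<close> lay outside the diagram,
    the count of the first \<open>k\<close> rows would miss it in its own column; one summand would
    be strictly below its bound, and so would the total.\<close>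
  proof (rule ccontr)
    assume "(row x, col x) \<notin> young_diagram lam"
    then have outside: "row x \<ge> h (col x)"
      by (simp add: cell)
    have "x \<in> {y \<in> X. col y = col x}" "x \<notin> {y \<in> {y \<in> X. row y < h (col x)}. col y = col x}"
      using x outside by simp_all
    then have "{y \<in> {y \<in> X. row y < h (col x)}. col y = col x} \<subset> {y \<in> X. col y = col x}"
      by blast
    then have "r (h (col x)) (col x) < card {y \<in> X. col y = col x}"
      unfolding r_def using X by (intro psubset_card_mono) simp_all
    also have "\<dots> = h (col x)"
      unfolding h_def by (rule col)
    finally have strict: "r (h (col x)) (col x) < h (col x)" .
    have "col x \<in> J"
      using J(2) x by blast
    have "(\<Sum>j\<in>J. r (h (col x)) j) < (\<Sum>j\<in>J. min (h (col x)) (h j))"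
    proof (rule sum_strict_mono_ex1[OF J(1)])
      show "\<forall>j\<in>J. r (h (col x)) j \<le> min (h (col x)) (h j)"
        using r_le by blast
      show "\<exists>j\<in>J. r (h (col x)) j < min (h (col x)) (h j)"
        using strict \<open>col x \<in> J\<close> by (intro bexI[of _ "col x"]) simp_all
    qed
    then show False
      using eq[of "h (col x)"] unfolding r rows by simp
  qed
qed

section \<open>Polytabloids and column antisymmetrizers\<close>

abbreviation (input) cscale :: "complex \<Rightarrow> ('a \<Rightarrow> complex) \<Rightarrow> 'a \<Rightarrow> complex" where
  "cscale c v \<equiv> \<lambda>x. c * v x"

definition delta :: "'a \<Rightarrow> 'a \<Rightarrow> complex" where
  "delta T = (\<lambda>U. if T = U then 1 else 0)"

lemma sum_fun_apply: "(\<Sum>i\<in>A. f i) x = (\<Sum>i\<in>A. (f i x :: complex))"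
  by (induction A rule: infinite_finite_induct) simp_all

lemma map_image_inv_eq_iff:
  assumes "bij \<pi>"
  shows "map (image (inv' \<pi>)) T = U \<longleftrightarrow> T = map (image \<pi>) U"
proof -
  have inv: "inv' \<pi> ` \<pi> ` A = A" "\<pi> ` inv' \<pi> ` B = B" for A B
    using assms by (simp_all add: bij_is_inj bij_is_surj image_f_inv_f)
  have "map (image (inv' \<pi>)) (map (image \<pi>) U) = U" "map (image \<pi>) (map (image (inv' \<pi>)) T) = T"
    by (simp_all add: inv map_idI)
  then show ?thesis
    by metis
qed

lemma tabloid_compose: "tabloid lam (\<pi> \<circ> t) = map (image \<pi>) (tabloid lam t)"
  by (simp add: tabloid_def image_comp comp_def)

lemma tabloid_action_delta:
  assumes "bij \<pi>"
  shows "tabloid_action \<pi> (delta T) = delta (map (image \<pi>) T)"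
proof
  fix U
  have "T = map (image (inv' \<pi>)) U \<longleftrightarrow> map (image \<pi>) T = U"
    using map_image_inv_eq_iff[OF assms, of U T] by metis
  then show "tabloid_action \<pi> (delta T) U = delta (map (image \<pi>) T) U"
    unfolding tabloid_action_def delta_def by simp
qed

lemma tabloid_action_id: "tabloid_action id v = v"
  by (simp add: tabloid_action_def)

lemma tabloid_action_compose:
  assumes "bij \<pi>" "bij \<sigma>"
  shows "tabloid_action (\<pi> \<circ> \<sigma>) v = tabloid_action \<pi> (tabloid_action \<sigma> v)"
  unfolding tabloid_action_def o_inv_distrib[OF assms] by (simp add: comp_def image_image)

lemma tabloid_action_sum: "tabloid_action \<pi> (\<Sum>i\<in>A. f i) = (\<Sum>i\<in>A. tabloid_action \<pi> (f i))"
  by (simp add: fun_eq_iff tabloid_action_def sum_fun_apply)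

lemma tabloid_action_add: "tabloid_action \<pi> (u + v) = tabloid_action \<pi> u + tabloid_action \<pi> v"
  by (simp add: fun_eq_iff tabloid_action_def)

lemma tabloid_action_cscale: "tabloid_action \<pi> (cscale c v) = cscale c (tabloid_action \<pi> v)"
  by (simp add: tabloid_action_def)

section \<open>Column stabilizers and signed column sums\<close>

definition column_set :: "nat list \<Rightarrow> (nat \<times> nat \<Rightarrow> nat) \<Rightarrow> nat \<Rightarrow> nat set" where
  "column_set lam t j = t ` {c \<in> young_diagram lam. snd c = j}"

lemma column_stabilizer_iff:
  "\<pi> \<in> column_stabilizer lam t \<longleftrightarrow>
     \<pi> permutes {1..sum_list lam} \<and> (\<forall>j. \<pi> ` column_set lam t j = column_set lam t j)"
  by (simp add: column_stabilizer_def column_set_def sym_group_carrier)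

lemma column_stabilizer_permutes: "\<pi> \<in> column_stabilizer lam t \<Longrightarrow> \<pi> permutes {1..sum_list lam}"
  by (simp add: column_stabilizer_iff)

lemma finite_column_stabilizer [simp]: "finite (column_stabilizer lam t)"
  by (rule finite_subset[OF _ finite_permutations[of "{1..sum_list lam}"]])
     (auto simp: column_stabilizer_iff)

lemma column_stabilizer_id: "id \<in> column_stabilizer lam t"
  by (simp add: column_stabilizer_iff permutes_id)

lemma column_stabilizer_compose:
  "\<pi> \<in> column_stabilizer lam t \<Longrightarrow> \<sigma> \<in> column_stabilizer lam t \<Longrightarrow> \<pi> \<circ> \<sigma> \<in> column_stabilizer lam t"
  unfolding column_stabilizer_iff image_comp[symmetric] by (auto intro: permutes_compose)

lemma column_stabilizer_inv:
  assumes "\<pi> \<in> column_stabilizer lam t"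
  shows "inv' \<pi> \<in> column_stabilizer lam t"
proof -
  have p: "\<pi> permutes {1..sum_list lam}" and c: "\<And>j. \<pi> ` column_set lam t j = column_set lam t j"
    using assms by (auto simp: column_stabilizer_iff)
  have "inv' \<pi> ` column_set lam t j = column_set lam t j" for j
    using image_inv_f_f[OF permutes_inj[OF p], of "column_set lam t j"] c by simp
  then show ?thesis
    using permutes_inv[OF p] by (simp add: column_stabilizer_iff)
qed

lemma permutation_if_permutes_interval: "\<pi> permutes {1..n::nat} \<Longrightarrow> permutation \<pi>"
  using permutation_permutes by blast

lemma column_set_compose: "column_set lam (\<pi> \<circ> t) j = \<pi> ` column_set lam t j"
  by (simp add: column_set_def image_comp)

lemma column_stabilizer_conjugate:
  assumes \<pi>: "\<pi> permutes {1..sum_list lam}" and \<sigma>: "\<sigma> \<in> column_stabilizer lam t"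
  shows "\<pi> \<circ> \<sigma> \<circ> inv' \<pi> \<in> column_stabilizer lam (\<pi> \<circ> t)"
proof -
  have "(\<pi> \<circ> \<sigma> \<circ> inv' \<pi>) ` column_set lam (\<pi> \<circ> t) j = column_set lam (\<pi> \<circ> t) j" for j
  proof -
    have "(\<pi> \<circ> \<sigma> \<circ> inv' \<pi>) ` column_set lam (\<pi> \<circ> t) j = \<pi> ` \<sigma> ` inv' \<pi> ` \<pi> ` column_set lam t j"
      by (simp add: column_set_compose image_comp)
    also have "\<dots> = \<pi> ` column_set lam t j"
      using \<sigma> by (simp add: image_inv_f_f[OF permutes_inj[OF \<pi>]] column_stabilizer_iff)
    finally show ?thesis
      by (simp add: column_set_compose)
  qed
  then show ?thesis
    using \<pi> \<sigma> by (simp add: column_stabilizer_iff permutes_compose permutes_inv)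
qed

lemma sign_conjugate:
  assumes "permutation \<pi>" "permutation \<sigma>"
  shows "sign (\<pi> \<circ> \<sigma> \<circ> inv' \<pi>) = sign \<sigma>"
proof -
  have "sign (\<pi> \<circ> \<sigma> \<circ> inv' \<pi>) = sign \<sigma> * (sign \<pi> * sign \<pi>)"
    using assms by (simp add: sign_compose permutation_compose permutation_inverse sign_inverse)
  then show ?thesis
    by (simp only: sign_idempotent mult_1_right)
qed

text \<open>Conjugation by \<open>\<pi>\<close> carries the column stabilizer of \<open>t\<close>
  onto that of \<open>\<pi> \<circ> t\<close> and preserves signs.\<close>

lemma tabloid_action_polytabloid:
  assumes \<pi>: "\<pi> permutes {1..sum_list lam}"
  shows "tabloid_action \<pi> (polytabloid lam t) = polytabloid lam (\<pi> \<circ> t)"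
proof
  fix T
  have bij: "bij \<pi>"
    using \<pi> by (rule permutes_bij)
  have perm: "permutation \<sigma>" if "\<sigma> permutes {1..sum_list lam}" for \<sigma>
    using that by (rule permutation_if_permutes_interval)
  have conj_inv: "inv' \<pi> \<circ> \<tau> \<circ> \<pi> \<in> column_stabilizer lam t" if "\<tau> \<in> column_stabilizer lam (\<pi> \<circ> t)" for \<tau>
  proof -
    have "inv' \<pi> \<circ> (\<pi> \<circ> t) = t"
      using permutes_inverses[OF \<pi>] by (simp add: fun_eq_iff)
    then show ?thesis
      using column_stabilizer_conjugate[OF permutes_inv[OF \<pi>] that]
      unfolding permutes_inv_inv[OF \<pi>] by simp
  qed
  have "tabloid_action \<pi> (polytabloid lam t) T =
        (\<Sum>\<sigma>\<in>column_stabilizer lam t. of_int (sign \<sigma>) *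
           (if tabloid lam (\<sigma> \<circ> t) = map (image (inv' \<pi>)) T then 1 else 0))"
    by (simp add: tabloid_action_def polytabloid_def)
  also have "\<dots> = (\<Sum>\<tau>\<in>column_stabilizer lam (\<pi> \<circ> t). of_int (sign \<tau>) *
           (if tabloid lam (\<tau> \<circ> (\<pi> \<circ> t)) = T then 1 else 0))"
  proof (rule sum.reindex_bij_witness[of _ "\<lambda>\<tau>. inv' \<pi> \<circ> \<tau> \<circ> \<pi>" "\<lambda>\<sigma>. \<pi> \<circ> \<sigma> \<circ> inv' \<pi>"])
    fix \<sigma>
    assume \<sigma>: "\<sigma> \<in> column_stabilizer lam t"
    show "inv' \<pi> \<circ> (\<pi> \<circ> \<sigma> \<circ> inv' \<pi>) \<circ> \<pi> = \<sigma>"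
      using permutes_inverses[OF \<pi>] by (simp add: fun_eq_iff)
    show "\<pi> \<circ> \<sigma> \<circ> inv' \<pi> \<in> column_stabilizer lam (\<pi> \<circ> t)"
      by (rule column_stabilizer_conjugate[OF \<pi> \<sigma>])
    have "sign (\<pi> \<circ> \<sigma> \<circ> inv' \<pi>) = sign \<sigma>"
      by (intro sign_conjugate perm \<pi> column_stabilizer_permutes[OF \<sigma>])
    moreover have "\<pi> \<circ> \<sigma> \<circ> inv' \<pi> \<circ> (\<pi> \<circ> t) = \<pi> \<circ> (\<sigma> \<circ> t)"
      using permutes_inverses[OF \<pi>] by (simp add: fun_eq_iff)
    then have "tabloid lam (\<pi> \<circ> \<sigma> \<circ> inv' \<pi> \<circ> (\<pi> \<circ> t)) = T \<longleftrightarrow>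
               tabloid lam (\<sigma> \<circ> t) = map (image (inv' \<pi>)) T"
      using map_image_inv_eq_iff[OF bij, of T "tabloid lam (\<sigma> \<circ> t)"] tabloid_compose[of lam \<pi> "\<sigma> \<circ> t"]
      by metis
    ultimately show "of_int (sign (\<pi> \<circ> \<sigma> \<circ> inv' \<pi>)) *
          (if tabloid lam (\<pi> \<circ> \<sigma> \<circ> inv' \<pi> \<circ> (\<pi> \<circ> t)) = T then 1 else 0) =
        (of_int (sign \<sigma>) * (if tabloid lam (\<sigma> \<circ> t) = map (image (inv' \<pi>)) T then 1 else 0) :: complex)"
      by simp
  next
    fix \<tau>
    assume \<tau>: "\<tau> \<in> column_stabilizer lam (\<pi> \<circ> t)"
    show "\<pi> \<circ> (inv' \<pi> \<circ> \<tau> \<circ> \<pi>) \<circ> inv' \<pi> = \<tau>"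
      using permutes_inverses[OF \<pi>] by (simp add: fun_eq_iff)
    show "inv' \<pi> \<circ> \<tau> \<circ> \<pi> \<in> column_stabilizer lam t"
      using \<tau> by (rule conj_inv)
  qed
  also have "\<dots> = polytabloid lam (\<pi> \<circ> t) T"
    by (simp add: polytabloid_def)
  finally show "tabloid_action \<pi> (polytabloid lam t) T = polytabloid lam (\<pi> \<circ> t) T" .
qed

text \<open>The group algebra element \<open>\<kappa>\<^sub>t\<close> of the theory of Specht
  modules, as an operator on all coefficient functions, so that it can be applied to tabloids of
  shapes other than \<open>lam\<close>.\<close>

definition column_antisymmetrizer ::
    "nat list \<Rightarrow> (nat \<times> nat \<Rightarrow> nat) \<Rightarrow> (nat set list \<Rightarrow> complex) \<Rightarrow> nat set list \<Rightarrow> complex" where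
  "column_antisymmetrizer lam t v =
     (\<Sum>\<pi>\<in>column_stabilizer lam t. cscale (of_int (sign \<pi>)) (tabloid_action \<pi> v))"

lemma column_antisymmetrizer_sum:
  "column_antisymmetrizer lam t (\<Sum>i\<in>A. f i) = (\<Sum>i\<in>A. column_antisymmetrizer lam t (f i))"
  by (simp add: column_antisymmetrizer_def tabloid_action_sum fun_eq_iff sum_fun_apply
      sum_distrib_left sum.swap[of _ A])

lemma column_antisymmetrizer_add:
  "column_antisymmetrizer lam t (u + v) = column_antisymmetrizer lam t u + column_antisymmetrizer lam t v"
  by (simp add: column_antisymmetrizer_def tabloid_action_add fun_eq_iff sum_fun_apply
      distrib_left sum.distrib)

lemma column_antisymmetrizer_cscale:
  "column_antisymmetrizer lam t (cscale c v) = cscale c (column_antisymmetrizer lam t v)"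
  unfolding column_antisymmetrizer_def tabloid_action_cscale
  by (rule ext, unfold sum_fun_apply sum_distrib_left, rule sum.cong[OF refl], rule mult.left_commute)

text \<open>Right translation by \<open>\<sigma>\<close> permutes the column stabilizer and changes
  every sign by \<open>sign \<sigma>\<close>.\<close>

lemma column_antisymmetrizer_shift:
  assumes \<sigma>: "\<sigma> \<in> column_stabilizer lam t"
  shows "column_antisymmetrizer lam t (tabloid_action \<sigma> v) =
         cscale (of_int (sign \<sigma>)) (column_antisymmetrizer lam t v)"
proof
  fix T
  have perm: "permutation \<pi>" "bij \<pi>" if "\<pi> \<in> column_stabilizer lam t" for \<pi>
    using column_stabilizer_permutes[OF that] by (auto intro: permutation_if_permutes_interval permutes_bij)
  have inv: "\<sigma> \<circ> inv' \<sigma> = id" "inv' \<sigma> \<circ> \<sigma> = id"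
    using permutes_inv_o[OF column_stabilizer_permutes[OF \<sigma>]] by auto
  have "column_antisymmetrizer lam t (tabloid_action \<sigma> v) T =
        (\<Sum>\<pi>\<in>column_stabilizer lam t. of_int (sign \<pi>) * tabloid_action (\<pi> \<circ> \<sigma>) v T)"
    using perm \<sigma> by (simp add: column_antisymmetrizer_def sum_fun_apply tabloid_action_compose)
  also have "\<dots> = (\<Sum>\<pi>\<in>column_stabilizer lam t. of_int (sign \<sigma>) * of_int (sign \<pi>) * tabloid_action \<pi> v T)"
  proof (rule sum.reindex_bij_witness[of _ "\<lambda>\<pi>. \<pi> \<circ> inv' \<sigma>" "\<lambda>\<pi>. \<pi> \<circ> \<sigma>"])
    fix \<pi>
    assume \<pi>: "\<pi> \<in> column_stabilizer lam t"
    show "\<pi> \<circ> \<sigma> \<circ> inv' \<sigma> = \<pi>" "\<pi> \<circ> inv' \<sigma> \<circ> \<sigma> = \<pi>"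
      by (simp_all add: comp_assoc inv)
    show "\<pi> \<circ> \<sigma> \<in> column_stabilizer lam t" "\<pi> \<circ> inv' \<sigma> \<in> column_stabilizer lam t"
      using \<pi> \<sigma> by (simp_all add: column_stabilizer_compose column_stabilizer_inv)
    have "sign \<sigma> * sign (\<pi> \<circ> \<sigma>) = sign \<pi>"
      using perm \<pi> \<sigma> by (simp add: sign_compose mult.left_commute)
    then show "of_int (sign \<sigma>) * of_int (sign (\<pi> \<circ> \<sigma>)) * tabloid_action (\<pi> \<circ> \<sigma>) v T =
               of_int (sign \<pi>) * tabloid_action (\<pi> \<circ> \<sigma>) v T"
      by (metis of_int_mult)
  qed
  also have "\<dots> = of_int (sign \<sigma>) * column_antisymmetrizer lam t v T"
    by (simp add: column_antisymmetrizer_def sum_fun_apply sum_distrib_left mult.assoc)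
  finally show "column_antisymmetrizer lam t (tabloid_action \<sigma> v) T =
                of_int (sign \<sigma>) * column_antisymmetrizer lam t v T" .
qed

lemma polytabloid_eq_antisymmetrizer:
  "polytabloid lam t = column_antisymmetrizer lam t (delta (tabloid lam t))"
proof
  fix T
  have "tabloid_action \<pi> (delta (tabloid lam t)) = delta (tabloid lam (\<pi> \<circ> t))"
    if "\<pi> \<in> column_stabilizer lam t" for \<pi>
    using tabloid_action_delta[OF permutes_bij[OF column_stabilizer_permutes[OF that]]]
    by (simp add: tabloid_compose)
  then show "polytabloid lam t T = column_antisymmetrizer lam t (delta (tabloid lam t)) T"
    by (simp add: polytabloid_def column_antisymmetrizer_def sum_fun_apply delta_def)
qed

text \<open>The quasi-idempotence of the antisymmetrizer: in its square, each element of the column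
  stabilizer contributes its sign twice. This gives the eigenvalue on the polytabloid.\<close>

lemma antisymmetrizer_polytabloid:
  "column_antisymmetrizer lam t (polytabloid lam t) =
   cscale (of_nat (card (column_stabilizer lam t))) (polytabloid lam t)"
proof -
  define w where "w = delta (tabloid lam t)"
  have "column_antisymmetrizer lam t (column_antisymmetrizer lam t w) =
        (\<Sum>\<pi>\<in>column_stabilizer lam t. cscale (of_int (sign \<pi>))
           (column_antisymmetrizer lam t (tabloid_action \<pi> w)))"
    by (subst (2) column_antisymmetrizer_def)
       (simp add: column_antisymmetrizer_sum column_antisymmetrizer_cscale)
  also have "\<dots> = (\<Sum>\<pi>\<in>column_stabilizer lam t. column_antisymmetrizer lam t w)"
  proof (rule sum.cong[OF refl])
    fix \<pi>
    assume \<pi>: "\<pi> \<in> column_stabilizer lam t"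
    have "of_int (sign \<pi>) * of_int (sign \<pi>) = (1 :: complex)"
      by (metis of_int_mult of_int_1 sign_idempotent)
    then show "cscale (of_int (sign \<pi>)) (column_antisymmetrizer lam t (tabloid_action \<pi> w)) =
               column_antisymmetrizer lam t w"
      unfolding column_antisymmetrizer_shift[OF \<pi>] by (simp add: mult.assoc[symmetric])
  qed
  also have "\<dots> = cscale (of_nat (card (column_stabilizer lam t))) (column_antisymmetrizer lam t w)"
    by (simp add: fun_eq_iff sum_fun_apply)
  finally show ?thesis
    by (simp add: polytabloid_eq_antisymmetrizer w_def)
qed

text \<open>The transposition of \<open>x\<close> and \<open>y\<close> lies in the column stabilizer
  and fixes the tabloid, so the antisymmetrized vector equals its own negative.\<close>

lemma antisymmetrizer_eq_0_if_shared_pair: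
  assumes xy: "x \<noteq> y" "x \<in> {1..sum_list lam}" "y \<in> {1..sum_list lam}"
    and cols: "\<And>j. x \<in> column_set lam t j \<longleftrightarrow> y \<in> column_set lam t j"
    and rows: "\<And>r. r \<in> set T \<Longrightarrow> x \<in> r \<longleftrightarrow> y \<in> r"
  shows "column_antisymmetrizer lam t (delta T) = 0"
proof -
  let ?\<tau> = "transpose x y"
  have \<tau>: "?\<tau> \<in> column_stabilizer lam t"
    using xy cols by (simp add: column_stabilizer_iff permutes_swap_id transpose_image_eq)
  have "map (image ?\<tau>) T = T"
    using rows by (intro map_idI) (simp add: transpose_image_eq)
  then have "tabloid_action ?\<tau> (delta T) = delta T"
    by (simp add: tabloid_action_delta)
  then have "column_antisymmetrizer lam t (delta T) = cscale (- 1) (column_antisymmetrizer lam t (delta T))"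
    using column_antisymmetrizer_shift[OF \<tau>, of "delta T"] xy(1) by (simp add: sign_swap_id)
  then have "column_antisymmetrizer lam t (delta T) U = - column_antisymmetrizer lam t (delta T) U" for U
    by (metis mult_minus1)
  then show ?thesis
    by (auto simp: fun_eq_iff)
qed

section \<open>Tableaux and dominance\<close>

lemma tableau_cell:
  assumes "is_tableau lam t" "x \<in> {1..sum_list lam}"
  shows "inv_into (young_diagram lam) t x \<in> young_diagram lam"
    and "t (inv_into (young_diagram lam) t x) = x"
  using assms by (auto simp: is_tableau_def bij_betw_def intro!: inv_into_into f_inv_into_f simp del: atLeastAtMost_iff)

lemma tableau_inj: "is_tableau lam t \<Longrightarrow> inj_on t (young_diagram lam)"
  by (simp add: is_tableau_def bij_betw_def)

lemma tableau_entry: "is_tableau lam t \<Longrightarrow> c \<in> young_diagram lam \<Longrightarrow> t c \<in> {1..sum_list lam}"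
  by (auto simp: is_tableau_def bij_betw_def)

lemma tabloid_nth: "i < length lam \<Longrightarrow> tabloid lam t ! i = t ` {c \<in> young_diagram lam. fst c = i}"
proof -
  assume i: "i < length lam"
  have "{c \<in> young_diagram lam. fst c = i} = (\<lambda>j. (i, j)) ` {..<lam ! i}"
    using i by (auto simp: young_diagram_def)
  then show ?thesis
    using i by (simp add: tabloid_def image_image)
qed

lemma is_tableau_compose:
  assumes "is_tableau lam t" "\<pi> permutes {1..sum_list lam}"
  shows "is_tableau lam (\<pi> \<circ> t)"
  using assms bij_betw_trans permutes_imp_bij unfolding is_tableau_def by blast

lemma tableau_exists: "\<exists>t. is_tableau lam t"
  unfolding is_tableau_def
  using finite_same_card_bij[of "young_diagram lam" "{1..sum_list lam}"] by (simp add: card_young_diagram)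

text \<open>The tableaux \<open>s\<close> and \<open>\<pi> \<circ> t\<close> agree on the diagram
  but may differ as functions outside it; hence the equality is one of polytabloids.\<close>

lemma tableau_transitive:
  assumes t: "is_tableau lam t" and s: "is_tableau lam s"
  obtains \<pi> where "\<pi> permutes {1..sum_list lam}" "polytabloid lam s = polytabloid lam (\<pi> \<circ> t)"
proof -
  let ?D = "young_diagram lam"
  define \<pi> where "\<pi> x = (if x \<in> {1..sum_list lam} then s (inv_into ?D t x) else x)" for x
  have "bij_betw (s \<circ> inv_into ?D t) {1..sum_list lam} {1..sum_list lam}"
    using t s unfolding is_tableau_def by (blast intro: bij_betw_trans bij_betw_inv_into)
  then have "bij_betw \<pi> {1..sum_list lam} {1..sum_list lam}"
    by (rule bij_betw_cong[THEN iffD1, rotated]) (simp add: \<pi>_def)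
  then have \<pi>: "\<pi> permutes {1..sum_list lam}"
    by (rule bij_imp_permutes) (simp only: \<pi>_def if_False)
  have eq: "(\<pi> \<circ> t) c = s c" if "c \<in> ?D" for c
    using that tableau_entry[OF t that] inv_into_f_f[OF tableau_inj[OF t] that] by (simp add: \<pi>_def)
  have "column_set lam s j = column_set lam (\<pi> \<circ> t) j" for j
    unfolding column_set_def using eq by (intro image_cong) auto
  then have "column_stabilizer lam s = column_stabilizer lam (\<pi> \<circ> t)"
    by (auto simp: column_stabilizer_iff)
  moreover have "tabloid lam (\<sigma> \<circ> s) = tabloid lam (\<sigma> \<circ> (\<pi> \<circ> t))" for \<sigma>
    using eq by (auto simp: tabloid_def young_diagram_def intro!: image_cong)
  ultimately have "polytabloid lam s = polytabloid lam (\<pi> \<circ> t)"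
    unfolding polytabloid_def by simp
  with \<pi> show thesis ..
qed

text \<open>
  Two entries sharing both a column of \<open>t\<close> and a row of the tabloid of \<open>s\<close> would make the
  antisymmetrized tabloid vanish, so the rows of the entries are distinct within each column of \<open>t\<close>.
\<close>

lemma antisymmetrizer_tabloid_nonzero:
  assumes lam: "is_partition n lam" and mu: "is_partition n mu"
    and t: "is_tableau lam t" and s: "is_tableau mu s"
    and nonzero: "column_antisymmetrizer lam t (delta (tabloid mu s)) \<noteq> 0"
  shows "sum_list (take k mu) \<le> sum_list (take k lam)"
    and "mu = lam \<Longrightarrow> \<exists>\<sigma>\<in>column_stabilizer lam t. tabloid mu s = tabloid lam (\<sigma> \<circ> t)"
proof -
  define X where "X = {1..n}"
  have n: "sum_list lam = n" "sum_list mu = n"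
    using lam mu by (auto simp: is_partition_def)
  \<comment> \<open>Each entry gets its row from \<open>s\<close>, of shape \<open>mu\<close>, and
    its column from \<open>t\<close>, of shape \<open>lam\<close>.\<close>
  define row where "row x = fst (inv_into (young_diagram mu) s x)" for x
  define col where "col x = snd (inv_into (young_diagram lam) t x)" for x
  have colt: "col (t c) = snd c" if "c \<in> young_diagram lam" for c
    using that tableau_inj[OF t] by (simp add: col_def)
  have rows: "row (s c) = fst c" if "c \<in> young_diagram mu" for c
    using that tableau_inj[OF s] by (simp add: row_def)
  have imt: "t ` young_diagram lam = X" and ims: "s ` young_diagram mu = X"
    using t s n by (auto simp: is_tableau_def bij_betw_def X_def)
  have column: "column_set lam t j = {x \<in> X. col x = j}" for j
    unfolding column_set_def imt[symmetric] using colt by auto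
  have row_set: "tabloid mu s ! i = {x \<in> X. row x = i}" if "i < length mu" for i
    unfolding tabloid_nth[OF that] ims[symmetric] using rows by auto
  have inj: "inj_on (\<lambda>x. (row x, col x)) X"
  proof (rule inj_onI, rule ccontr)
    fix x y
    assume xy: "x \<in> X" "y \<in> X" "(row x, col x) = (row y, col y)" "x \<noteq> y"
    have "column_antisymmetrizer lam t (delta (tabloid mu s)) = 0"
    proof (rule antisymmetrizer_eq_0_if_shared_pair[OF xy(4)])
      show "x \<in> {1..sum_list lam}" "y \<in> {1..sum_list lam}"
        using xy n by (simp_all add: X_def)
      show "x \<in> column_set lam t j \<longleftrightarrow> y \<in> column_set lam t j" for j
        using xy by (simp add: column)
      fix r
      assume "r \<in> set (tabloid mu s)"
      then obtain i where "i < length mu" "r = tabloid mu s ! i"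
        by (auto simp: in_set_conv_nth tabloid_def)
      then show "x \<in> r \<longleftrightarrow> y \<in> r"
        using xy by (simp add: row_set)
    qed
    with nonzero show False ..
  qed
  have col_card: "card {x \<in> X. col x = j} = card {i. (i, j) \<in> young_diagram lam}" for j
  proof -
    have "{x \<in> X. col x = j} = t ` (\<lambda>i. (i, j)) ` {i. (i, j) \<in> young_diagram lam}"
      unfolding column[symmetric] column_set_def by (rule arg_cong[of _ _ "image t"]) force
    moreover have "inj_on t ((\<lambda>i. (i, j)) ` {i. (i, j) \<in> young_diagram lam})"
      using tableau_inj[OF t] by (rule inj_on_subset) auto
    ultimately show ?thesis
      by (simp add: card_image inj_on_def)
  qed
  have row_card: "card {x \<in> X. row x < k} = sum_list (take k mu)" for k
  proof -
    have "{x \<in> X. row x < k} = s ` {c \<in> young_diagram mu. fst c < k}"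
      unfolding ims[symmetric] using rows by auto
    moreover have "inj_on s {c \<in> young_diagram mu. fst c < k}"
      using tableau_inj[OF s] by (rule inj_on_subset) auto
    ultimately show ?thesis
      by (simp add: card_image card_young_diagram_rows)
  qed
  have finX: "finite X"
    by (simp add: X_def)
  show "sum_list (take k mu) \<le> sum_list (take k lam)"
    using card_rows_le[OF lam finX col_card inj, of k] by (simp add: row_card)
  assume eq: "mu = lam"
  have cell: "(row x, col x) \<in> young_diagram lam" if "x \<in> X" for x
    by (rule column_injective_rows(2)[OF lam finX col_card inj _ that]) (simp add: row_card eq)
  \<comment> \<open>\<open>\<psi>\<close> moves each entry within its column of \<open>t\<close> to
    the height it has in \<open>s\<close>. It is thus a column permutation taking the tabloid of
    \<open>s\<close> to that of \<open>t\<close>; its inverse is the required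
    \<open>\<sigma>\<close>.\<close>
  define \<psi> where "\<psi> x = (if x \<in> X then t (row x, col x) else x)" for x
  have inj\<psi>: "inj_on \<psi> X"
  proof (rule inj_onI)
    fix x y
    assume xy: "x \<in> X" "y \<in> X" "\<psi> x = \<psi> y"
    then have "t (row x, col x) = t (row y, col y)"
      by (simp add: \<psi>_def)
    then have "(row x, col x) = (row y, col y)"
      by (rule inj_onD[OF tableau_inj[OF t] _ cell[OF xy(1)] cell[OF xy(2)]])
    then show "x = y"
      by (rule inj_onD[OF inj _ xy(1,2)])
  qed
  have "\<psi> ` X \<subseteq> X"
    using cell imt by (auto simp: \<psi>_def)
  then have surj: "\<psi> ` X = X"
    by (rule endo_inj_surj[OF finX _ inj\<psi>])
  have \<psi>: "\<psi> permutes X"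
    using inj\<psi> surj by (intro bij_imp_permutes) (auto simp: bij_betw_def \<psi>_def)
  have "\<psi> ` column_set lam t j = column_set lam t j" for j
  proof (rule endo_inj_surj)
    show "finite (column_set lam t j)"
      using finX by (simp add: column)
    show "\<psi> ` column_set lam t j \<subseteq> column_set lam t j"
    proof
      fix y
      assume "y \<in> \<psi> ` column_set lam t j"
      then obtain x where x: "x \<in> X" "col x = j" "y = t (row x, col x)"
        by (auto simp: column \<psi>_def)
      then show "y \<in> column_set lam t j"
        using cell[OF x(1)] by (auto simp: column_set_def)
    qed
    show "inj_on \<psi> (column_set lam t j)"
      using inj\<psi> by (rule inj_on_subset) (auto simp: column)
  qed
  then have \<psi>_stab: "\<psi> \<in> column_stabilizer lam t"
    using \<psi> n by (simp add: column_stabilizer_iff X_def)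
  have "\<psi> ` tabloid mu s ! i = tabloid lam t ! i" if i: "i < length lam" for i
  proof -
    have "\<psi> ` {x \<in> X. row x = i} = t ` {c \<in> young_diagram lam. fst c = i}"
    proof (intro equalityI subsetI)
      fix y
      assume "y \<in> \<psi> ` {x \<in> X. row x = i}"
      then show "y \<in> t ` {c \<in> young_diagram lam. fst c = i}"
        using cell by (force simp: \<psi>_def)
    next
      fix y
      assume "y \<in> t ` {c \<in> young_diagram lam. fst c = i}"
      then obtain c where c: "c \<in> young_diagram lam" "fst c = i" "y = t c"
        by auto
      then have "t c \<in> X"
        using imt by blast
      then have "t c \<in> \<psi> ` X"
        by (simp add: surj)
      then obtain x where x: "x \<in> X" "t c = \<psi> x"
        by blast
      then have "t c = t (row x, col x)"
        by (simp add: \<psi>_def)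
      then have "c = (row x, col x)"
        by (rule inj_onD[OF tableau_inj[OF t] _ c(1) cell[OF x(1)]])
      then have "row x = i"
        using c(2) by simp
      then show "y \<in> \<psi> ` {x \<in> X. row x = i}"
        using x c(3) by (intro image_eqI[of _ _ x]) simp_all
    qed
    then show ?thesis
      using row_set[of i] tabloid_nth[OF i, of t] i eq by simp
  qed
  then have "map (image \<psi>) (tabloid mu s) = tabloid lam t"
    using eq by (intro nth_equalityI) (auto simp: tabloid_def)
  then have "tabloid mu s = map (image (inv' \<psi>)) (tabloid lam t)"
    using map_image_inv_eq_iff[OF permutes_bij[OF \<psi>]] by metis
  then show "\<exists>\<sigma>\<in>column_stabilizer lam t. tabloid mu s = tabloid lam (\<sigma> \<circ> t)"
    using column_stabilizer_inv[OF \<psi>_stab] by (auto simp: tabloid_compose)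
qed

text \<open>The permutation module \<open>M\<^sup>\<lambda>\<close>, embedded in the functions on
  all lists of sets.\<close>

definition tabloid_module :: "nat list \<Rightarrow> (nat set list \<Rightarrow> complex) set" where
  "tabloid_module lam = cfun.span {delta (tabloid lam s) | s. is_tableau lam s}"

lemma finite_tabloids: "finite {delta (tabloid lam s) | s. is_tableau lam s}"
proof -
  have "{tabloid lam s | s. is_tableau lam s} \<subseteq> {T. set T \<subseteq> Pow {1..sum_list lam} \<and> length T = length lam}"
    using tableau_entry by (fastforce simp: tabloid_def young_diagram_def)
  then have "finite {tabloid lam s | s. is_tableau lam s}"
    by (rule finite_subset) (simp add: finite_lists_length_eq)
  moreover have "{delta (tabloid lam s) | s. is_tableau lam s} = delta ` {tabloid lam s | s. is_tableau lam s}"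
    by blast
  ultimately show ?thesis
    by simp
qed

text \<open>A tabloid that is not killed is a column translate of the tabloid of \<open>t\<close>
  and therefore goes to plus or minus the polytabloid; linearity does the rest.\<close>

lemma antisymmetrizer_tabloid_module:
  assumes "is_partition n lam" "is_tableau lam t" "v \<in> tabloid_module lam"
  shows "\<exists>c. column_antisymmetrizer lam t v = cscale c (polytabloid lam t)"
  using assms(3) unfolding tabloid_module_def
proof (induction rule: cfun.span_induct)
  show "cfun.subspace {v. \<exists>c. column_antisymmetrizer lam t v = cscale c (polytabloid lam t)}"
  proof (rule cfun.subspaceI)
    show "0 \<in> {v. \<exists>c. column_antisymmetrizer lam t v = cscale c (polytabloid lam t)}"
      using column_antisymmetrizer_cscale[of lam t 0 0] by (auto intro!: exI[of _ 0] simp: zero_fun_def)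
  next
    fix u v
    assume "u \<in> {v. \<exists>c. column_antisymmetrizer lam t v = cscale c (polytabloid lam t)}"
      "v \<in> {v. \<exists>c. column_antisymmetrizer lam t v = cscale c (polytabloid lam t)}"
    then obtain a b where "column_antisymmetrizer lam t u = cscale a (polytabloid lam t)"
      "column_antisymmetrizer lam t v = cscale b (polytabloid lam t)" by blast
    then have "column_antisymmetrizer lam t (u + v) = cscale (a + b) (polytabloid lam t)"
      by (simp add: column_antisymmetrizer_add fun_eq_iff distrib_right)
    then show "u + v \<in> {v. \<exists>c. column_antisymmetrizer lam t v = cscale c (polytabloid lam t)}"
      by (intro CollectI exI[of _ "a + b"])
  next
    fix a v
    assume "v \<in> {v. \<exists>c. column_antisymmetrizer lam t v = cscale c (polytabloid lam t)}"
    then obtain b where "column_antisymmetrizer lam t v = cscale b (polytabloid lam t)" by blast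
    then have "column_antisymmetrizer lam t (cscale a v) = cscale (a * b) (polytabloid lam t)"
      by (simp only: column_antisymmetrizer_cscale mult.assoc)
    then show "cscale a v \<in> {v. \<exists>c. column_antisymmetrizer lam t v = cscale c (polytabloid lam t)}"
      by (intro CollectI exI[of _ "a * b"])
  qed
next
  fix v
  assume "v \<in> {delta (tabloid lam s) | s. is_tableau lam s}"
  then obtain s where s: "is_tableau lam s" and v: "v = delta (tabloid lam s)" by blast
  show "\<exists>c. column_antisymmetrizer lam t v = cscale c (polytabloid lam t)"
  proof (cases "column_antisymmetrizer lam t v = 0")
    case True
    then show ?thesis
      by (intro exI[of _ 0]) (simp add: zero_fun_def)
  next
    case False
    then obtain \<sigma> where \<sigma>: "\<sigma> \<in> column_stabilizer lam t" "tabloid lam s = tabloid lam (\<sigma> \<circ> t)"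
      using antisymmetrizer_tabloid_nonzero(2)[OF assms(1,1,2) s] v by blast
    then have "v = tabloid_action \<sigma> (delta (tabloid lam t))"
      using tabloid_action_delta[OF permutes_bij[OF column_stabilizer_permutes[OF \<sigma>(1)]]]
      by (simp add: v tabloid_compose)
    then show ?thesis
      using column_antisymmetrizer_shift[OF \<sigma>(1)] polytabloid_eq_antisymmetrizer by metis
  qed
qed

text \<open>A surviving tabloid would force \<open>lam\<close> to dominate \<open>mu\<close>,
  against the \<open>k\<close>-th prefix sums.\<close>

lemma antisymmetrizer_tabloid_module_eq_0:
  assumes lam: "is_partition n lam" and mu: "is_partition n mu" and t: "is_tableau lam t"
    and k: "sum_list (take k mu) > sum_list (take k lam)" and v: "v \<in> tabloid_module mu"
  shows "column_antisymmetrizer lam t v = 0"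
  using v unfolding tabloid_module_def
proof (induction rule: cfun.span_induct)
  show "cfun.subspace {v. column_antisymmetrizer lam t v = 0}"
  proof (rule cfun.subspaceI)
    show "0 \<in> {v. column_antisymmetrizer lam t v = 0}"
      using column_antisymmetrizer_cscale[of lam t 0 0] by (simp add: zero_fun_def)
    show "cscale c v \<in> {v. column_antisymmetrizer lam t v = 0}"
      if "v \<in> {v. column_antisymmetrizer lam t v = 0}" for c v
      using that by (simp add: column_antisymmetrizer_cscale zero_fun_def)
  qed (simp add: column_antisymmetrizer_add)
next
  fix v
  assume "v \<in> {delta (tabloid mu s) | s. is_tableau mu s}"
  then show "column_antisymmetrizer lam t v = 0"
    using antisymmetrizer_tabloid_nonzero(1)[OF lam mu t, of _ k] k by (auto simp: not_le[symmetric])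
qed

lemma polytabloid_in_tabloid_module:
  assumes "is_tableau lam t"
  shows "polytabloid lam t \<in> tabloid_module lam"
proof -
  have "polytabloid lam t = (\<Sum>\<pi>\<in>column_stabilizer lam t. cscale (of_int (sign \<pi>)) (delta (tabloid lam (\<pi> \<circ> t))))"
    by (simp add: polytabloid_def delta_def fun_eq_iff sum_fun_apply)
  also have "\<dots> \<in> tabloid_module lam"
    unfolding tabloid_module_def
    by (intro cfun.span_sum cfun.span_scale cfun.span_base)
       (use is_tableau_compose[OF assms] column_stabilizer_permutes in blast)
  finally show ?thesis .
qed

lemma specht_module_subset: "specht_module lam \<subseteq> tabloid_module lam"
  unfolding specht_module_def
  by (rule cfun.span_minimal) (auto simp: polytabloid_in_tabloid_module, simp add: tabloid_module_def)

text \<open>The coefficient at the tabloid of \<open>t\<close> is 1: a permutation preserving every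
  row and every column of \<open>t\<close> fixes each entry.\<close>

lemma polytabloid_nonzero:
  assumes t: "is_tableau lam t"
  shows "polytabloid lam t \<noteq> 0"
proof -
  have "\<pi> = id" if \<pi>: "\<pi> \<in> column_stabilizer lam t" and same: "tabloid lam (\<pi> \<circ> t) = tabloid lam t" for \<pi>
  proof -
    have "\<pi> (t c) = t c" if c: "c \<in> young_diagram lam" for c
    proof -
      have len: "fst c < length lam"
        using c by (auto simp: young_diagram_def)
      have "(\<pi> \<circ> t) c \<in> tabloid lam t ! fst c"
        using c unfolding same[symmetric] tabloid_nth[OF len] by blast
      then obtain r where r: "r \<in> young_diagram lam" "fst r = fst c" "\<pi> (t c) = t r"
        unfolding tabloid_nth[OF len] by auto
      have "t c \<in> column_set lam t (snd c)"
        using c by (auto simp: column_set_def)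
      then have "\<pi> (t c) \<in> column_set lam t (snd c)"
        using \<pi> unfolding column_stabilizer_iff by blast
      then obtain d where d: "d \<in> young_diagram lam" "snd d = snd c" "\<pi> (t c) = t d"
        by (auto simp: column_set_def)
      have "r = d"
        using inj_onD[OF tableau_inj[OF t]] r d by metis
      then have "r = c"
        using r d by (simp add: prod_eq_iff)
      then show ?thesis
        using r by simp
    qed
    then have "\<pi> x = x" if "x \<in> {1..sum_list lam}" for x
      using tableau_cell[OF t that] by metis
    then show ?thesis
      using permutes_not_in[OF column_stabilizer_permutes[OF \<pi>]] by (metis eq_id_iff)
  qed
  then have "of_int (sign \<pi>) * (if tabloid lam (\<pi> \<circ> t) = tabloid lam t then 1 else 0) =
             (if \<pi> = id then 1 else (0::complex))" if "\<pi> \<in> column_stabilizer lam t" for \<pi>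
    using that by (auto simp: sign_id)
  then have "polytabloid lam t (tabloid lam t) = (\<Sum>\<pi>\<in>column_stabilizer lam t. if \<pi> = id then 1 else 0)"
    unfolding polytabloid_def by (intro sum.cong refl)
  also have "\<dots> = 1"
    by (simp add: column_stabilizer_id)
  finally show ?thesis
    by auto
qed

section \<open>Characters of Specht modules\<close>

text \<open>The same choice term as in \<open>trace_on\<close>, so that \<open>chi\<close> is
  literally the trace of \<open>specht_matrix\<close>, whose indices are the basis vectors
  themselves.\<close>

definition specht_basis :: "nat list \<Rightarrow> (nat set list \<Rightarrow> complex) set" where
  "specht_basis lam = (SOME B. cfun.independent B \<and> cfun.span B = specht_module lam)"

definition specht_matrix ::
    "nat list \<Rightarrow> (nat \<Rightarrow> nat) \<Rightarrow> (nat set list \<Rightarrow> complex) \<Rightarrow> (nat set list \<Rightarrow> complex) \<Rightarrow> complex" where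
  "specht_matrix lam \<pi> i j = cfun.representation (specht_basis lam) (tabloid_action \<pi> j) i"

lemma chi_eq_trace: "chi lam \<pi> = (\<Sum>b\<in>specht_basis lam. specht_matrix lam \<pi> b b)"
  by (simp add: chi_def trace_on_def specht_basis_def specht_matrix_def Let_def)

lemma specht_subspace: "cfun.subspace (specht_module lam)"
  by (simp add: specht_module_def)

lemma specht_basis:
  shows independent_specht_basis: "cfun.independent (specht_basis lam)"
    and span_specht_basis: "cfun.span (specht_basis lam) = specht_module lam"
proof -
  obtain B where "B \<subseteq> specht_module lam" "cfun.independent B" "specht_module lam \<subseteq> cfun.span B"
    by (rule cfun.maximal_independent_subset)
  then have "cfun.independent B \<and> cfun.span B = specht_module lam"
    using cfun.span_minimal[OF _ specht_subspace] by blast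
  then have "cfun.independent (specht_basis lam) \<and> cfun.span (specht_basis lam) = specht_module lam"
    unfolding specht_basis_def by (rule someI)
  then show "cfun.independent (specht_basis lam)" "cfun.span (specht_basis lam) = specht_module lam"
    by blast+
qed

lemma specht_basis_subset: "b \<in> specht_basis lam \<Longrightarrow> b \<in> specht_module lam"
  unfolding span_specht_basis[symmetric] by (rule cfun.span_base)

lemma finite_specht_basis [simp]: "finite (specht_basis lam)"
proof -
  have "specht_basis lam \<subseteq> cfun.span {delta (tabloid lam s) | s. is_tableau lam s}"
    using specht_basis_subset specht_module_subset unfolding tabloid_module_def by blast
  then show ?thesis
    using cfun.independent_span_bound[OF finite_tabloids independent_specht_basis] by blast
qed

lemma polytabloid_in_specht: "is_tableau lam t \<Longrightarrow> polytabloid lam t \<in> specht_module lam"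
  unfolding specht_module_def by (rule cfun.span_base) blast

lemma tabloid_action_specht:
  assumes \<pi>: "\<pi> permutes {1..sum_list lam}" and v: "v \<in> specht_module lam"
  shows "tabloid_action \<pi> v \<in> specht_module lam"
  using v unfolding specht_module_def
proof (induction rule: cfun.span_induct)
  show "cfun.subspace {v. tabloid_action \<pi> v \<in> cfun.span {polytabloid lam t |t. is_tableau lam t}}"
  proof (rule cfun.subspaceI)
    have "tabloid_action \<pi> 0 = 0"
      by (simp add: tabloid_action_def fun_eq_iff)
    then show "0 \<in> {v. tabloid_action \<pi> v \<in> cfun.span {polytabloid lam t |t. is_tableau lam t}}"
      by (simp add: cfun.span_zero)
    show "cscale c v \<in> {v. tabloid_action \<pi> v \<in> cfun.span {polytabloid lam t |t. is_tableau lam t}}"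
      if "v \<in> {v. tabloid_action \<pi> v \<in> cfun.span {polytabloid lam t |t. is_tableau lam t}}" for c v
      using that unfolding mem_Collect_eq tabloid_action_cscale by (rule cfun.span_scale)
  qed (simp add: tabloid_action_add cfun.span_add)
next
  fix v
  assume "v \<in> {polytabloid lam t |t. is_tableau lam t}"
  then obtain t where "is_tableau lam t" "v = polytabloid lam t" by blast
  then have "tabloid_action \<pi> v \<in> {polytabloid lam t |t. is_tableau lam t}"
    using is_tableau_compose[OF _ \<pi>] tabloid_action_polytabloid[OF \<pi>] by blast
  then show "tabloid_action \<pi> v \<in> cfun.span {polytabloid lam t |t. is_tableau lam t}"
    by (rule cfun.span_base)
qed

section \<open>Coordinates and the commutant of a Specht module\<close>

abbreviation (input) specht_coord :: "nat list \<Rightarrow> (nat set list \<Rightarrow> complex) \<Rightarrow> (nat set list \<Rightarrow> complex) \<Rightarrow> complex" where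
  "specht_coord lam \<equiv> cfun.representation (specht_basis lam)"

lemma coord_expansion:
  assumes "v \<in> specht_module lam"
  shows "(\<Sum>b\<in>specht_basis lam. cscale (specht_coord lam v b) b) = v"
  using assms independent_specht_basis
  by (intro cfun.sum_representation_eq) (simp_all add: span_specht_basis)

lemma coord_eqI: "u \<in> specht_module lam \<Longrightarrow> v \<in> specht_module lam \<Longrightarrow> (\<And>b. b \<in> specht_basis lam \<Longrightarrow> specht_coord lam u b = specht_coord lam v b) \<Longrightarrow> u = v"
proof -
  assume "u \<in> specht_module lam" "v \<in> specht_module lam" and eq: "\<And>b. b \<in> specht_basis lam \<Longrightarrow> specht_coord lam u b = specht_coord lam v b"
  then have "u = (\<Sum>b\<in>specht_basis lam. cscale (specht_coord lam u b) b)"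
    by (simp only: coord_expansion)
  also have "\<dots> = (\<Sum>b\<in>specht_basis lam. cscale (specht_coord lam v b) b)"
    by (rule sum.cong[OF refl]) (simp only: eq)
  also have "\<dots> = v"
    using \<open>v \<in> specht_module lam\<close> by (rule coord_expansion)
  finally show "u = v" .
qed

lemma coord_combination:
  assumes "\<And>p. p \<in> P \<Longrightarrow> f p \<in> specht_module lam"
  shows "specht_coord lam (\<Sum>p\<in>P. cscale (c p) (f p)) b = (\<Sum>p\<in>P. c p * specht_coord lam (f p) b)"
proof -
  have "specht_coord lam (\<Sum>p\<in>P. cscale (c p) (f p)) = (\<lambda>b. \<Sum>p\<in>P. specht_coord lam (cscale (c p) (f p)) b)"
    using assms
    by (intro cfun.representation_sum independent_specht_basis)
       (simp add: span_specht_basis cfun.subspace_scale[OF specht_subspace])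
  moreover have "specht_coord lam (cscale (c p) (f p)) b = c p * specht_coord lam (f p) b" if "p \<in> P" for p
    using assms[OF that]
    by (subst cfun.representation_scale[OF independent_specht_basis]) (simp_all add: span_specht_basis)
  ultimately show ?thesis
    by simp
qed

lemma combination_in_specht:
  "(\<And>p. p \<in> P \<Longrightarrow> f p \<in> specht_module lam) \<Longrightarrow> (\<Sum>p\<in>P. cscale (c p) (f p)) \<in> specht_module lam"
  by (intro cfun.subspace_sum[OF specht_subspace] cfun.subspace_scale[OF specht_subspace])

lemma coord_basis: "j \<in> specht_basis lam \<Longrightarrow> specht_coord lam j i = of_bool (i = j)"
  by (simp add: cfun.representation_basis[OF independent_specht_basis])

lemma coord_action:
  assumes \<pi>: "\<pi> permutes {1..sum_list lam}" and v: "v \<in> specht_module lam"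
  shows "specht_coord lam (tabloid_action \<pi> v) i = (\<Sum>j\<in>specht_basis lam. specht_matrix lam \<pi> i j * specht_coord lam v j)"
proof -
  have "tabloid_action \<pi> v = tabloid_action \<pi> (\<Sum>j\<in>specht_basis lam. cscale (specht_coord lam v j) j)"
    by (simp only: coord_expansion[OF v])
  also have "\<dots> = (\<Sum>j\<in>specht_basis lam. cscale (specht_coord lam v j) (tabloid_action \<pi> j))"
    by (simp only: tabloid_action_sum tabloid_action_cscale)
  finally have "specht_coord lam (tabloid_action \<pi> v) i =
      specht_coord lam (\<Sum>j\<in>specht_basis lam. cscale (specht_coord lam v j) (tabloid_action \<pi> j)) i"
    by (rule arg_cong)
  also have "\<dots> = (\<Sum>j\<in>specht_basis lam. specht_coord lam v j * specht_coord lam (tabloid_action \<pi> j) i)"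
    by (rule coord_combination) (rule tabloid_action_specht[OF \<pi> specht_basis_subset])
  finally have "specht_coord lam (tabloid_action \<pi> v) i = (\<Sum>j\<in>specht_basis lam. specht_coord lam v j * specht_coord lam (tabloid_action \<pi> j) i)" .
  then show ?thesis
    by (simp add: specht_matrix_def mult.commute)
qed

text \<open>The matrix defines an endomorphism \<open>\<theta>\<close> commuting with the group,
  hence with the antisymmetrizer of a tableau \<open>t\<close>. As the latter maps into the line of
  the polytabloid, that polytabloid is an eigenvector of \<open>\<theta>\<close>; the group action
  spreads the eigenvalue to all polytabloids, which span the module.\<close>

lemma specht_commutant:
  assumes lam: "is_partition n lam"
    and comm: "\<And>\<pi> i j. \<pi> permutes {1..n} \<Longrightarrow> i \<in> specht_basis lam \<Longrightarrow> j \<in> specht_basis lam \<Longrightarrow>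
      (\<Sum>k\<in>specht_basis lam. specht_matrix lam \<pi> i k * A k j) = (\<Sum>k\<in>specht_basis lam. A i k * specht_matrix lam \<pi> k j)"
  shows "\<exists>c. \<forall>i\<in>specht_basis lam. \<forall>j\<in>specht_basis lam. A i j = c * of_bool (i = j)"
proof -
  have n: "sum_list lam = n"
    using lam by (simp add: is_partition_def)
  define w where "w j = (\<Sum>i\<in>specht_basis lam. cscale (A i j) i)" for j
  define \<theta> where "\<theta> v = (\<Sum>j\<in>specht_basis lam. cscale (specht_coord lam v j) (w j))" for v
  have w: "w j \<in> specht_module lam" for j
    unfolding w_def by (intro combination_in_specht specht_basis_subset)
  have \<theta>: "\<theta> v \<in> specht_module lam" for v
    unfolding \<theta>_def by (intro combination_in_specht w)
  have coord_w: "specht_coord lam (w j) i = A i j" if "i \<in> specht_basis lam" for i j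
  proof -
    have "specht_coord lam (w j) i = (\<Sum>k\<in>specht_basis lam. A k j * specht_coord lam k i)"
      unfolding w_def by (rule coord_combination[OF specht_basis_subset])
    also have "\<dots> = (\<Sum>k\<in>specht_basis lam. if i = k then A k j else 0)"
      by (intro sum.cong refl) (simp add: coord_basis)
    finally show ?thesis
      using that by simp
  qed
  have coord_\<theta>: "specht_coord lam (\<theta> v) i = (\<Sum>j\<in>specht_basis lam. specht_coord lam v j * A i j)" if "i \<in> specht_basis lam" for v i
  proof -
    have "specht_coord lam (\<theta> v) i = (\<Sum>j\<in>specht_basis lam. specht_coord lam v j * specht_coord lam (w j) i)"
      unfolding \<theta>_def by (rule coord_combination) (rule w)
    then show ?thesis
      by (simp only: coord_w[OF that])
  qed
  \<comment> \<open>Membership in the module is required because \<open>cfun.representation\<close>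
    defaults to 0 outside the span, where linearity may fail.\<close>
  have \<theta>_combination: "\<theta> (\<Sum>p\<in>P. cscale (c p) (f p)) = (\<Sum>p\<in>P. cscale (c p) (\<theta> (f p)))"
    if f: "\<And>p. p \<in> P \<Longrightarrow> f p \<in> specht_module lam" for P :: "'p set" and c f
  proof (rule coord_eqI)
    fix i
    assume i: "i \<in> specht_basis lam"
    have combination: "specht_coord lam (\<Sum>p\<in>P. cscale (c p) (f p)) b = (\<Sum>p\<in>P. c p * specht_coord lam (f p) b)" for b
      by (rule coord_combination) (rule f)
    have \<theta>_comb: "specht_coord lam (\<Sum>p\<in>P. cscale (c p) (\<theta> (f p))) b = (\<Sum>p\<in>P. c p * specht_coord lam (\<theta> (f p)) b)" for b
      by (rule coord_combination) (rule \<theta>)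
    have "specht_coord lam (\<theta> (\<Sum>p\<in>P. cscale (c p) (f p))) i = (\<Sum>j\<in>specht_basis lam. \<Sum>p\<in>P. c p * (specht_coord lam (f p) j * A i j))"
      unfolding coord_\<theta>[OF i] combination by (simp add: sum_distrib_right mult.assoc)
    also have "\<dots> = (\<Sum>p\<in>P. \<Sum>j\<in>specht_basis lam. c p * (specht_coord lam (f p) j * A i j))"
      by (rule sum.swap)
    also have "\<dots> = specht_coord lam (\<Sum>p\<in>P. cscale (c p) (\<theta> (f p))) i"
      unfolding \<theta>_comb coord_\<theta>[OF i] by (simp add: sum_distrib_left)
    finally show "specht_coord lam (\<theta> (\<Sum>p\<in>P. cscale (c p) (f p))) i = specht_coord lam (\<Sum>p\<in>P. cscale (c p) (\<theta> (f p))) i" .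
  qed (auto intro: \<theta> combination_in_specht)
  have \<theta>_scale: "\<theta> (cscale c v) = cscale c (\<theta> v)" if "v \<in> specht_module lam" for c v
    using \<theta>_combination[of "{()}" "\<lambda>_. v" "\<lambda>_. c"] that by simp
  have \<theta>_add: "\<theta> (u + v) = \<theta> u + \<theta> v" if "u \<in> specht_module lam" "v \<in> specht_module lam" for u v
    using \<theta>_combination[of "{True, False}" "\<lambda>b. if b then u else v" "\<lambda>_. 1"] that by simp
  have \<theta>_action: "\<theta> (tabloid_action \<pi> v) = tabloid_action \<pi> (\<theta> v)"
    if \<pi>: "\<pi> permutes {1..n}" and v: "v \<in> specht_module lam" for \<pi> v
  proof (rule coord_eqI)
    have \<pi>': "\<pi> permutes {1..sum_list lam}"
      using \<pi> n by simp
    show "tabloid_action \<pi> (\<theta> v) \<in> specht_module lam"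
      by (rule tabloid_action_specht[OF \<pi>' \<theta>])
    fix i
    assume i: "i \<in> specht_basis lam"
    have "specht_coord lam (\<theta> (tabloid_action \<pi> v)) i = (\<Sum>k\<in>specht_basis lam. \<Sum>j\<in>specht_basis lam. specht_coord lam v j * (A i k * specht_matrix lam \<pi> k j))"
      unfolding coord_\<theta>[OF i] coord_action[OF \<pi>' v] sum_distrib_right
      by (intro sum.cong refl) (simp only: mult_ac)
    also have "\<dots> = (\<Sum>j\<in>specht_basis lam. specht_coord lam v j * (\<Sum>k\<in>specht_basis lam. A i k * specht_matrix lam \<pi> k j))"
      unfolding sum_distrib_left by (rule sum.swap)
    also have "\<dots> = (\<Sum>j\<in>specht_basis lam. specht_coord lam v j * (\<Sum>k\<in>specht_basis lam. specht_matrix lam \<pi> i k * A k j))"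
      using comm[OF \<pi> i] by (intro sum.cong refl) simp
    also have "\<dots> = (\<Sum>k\<in>specht_basis lam. \<Sum>j\<in>specht_basis lam. specht_matrix lam \<pi> i k * (specht_coord lam v j * A k j))"
      unfolding sum_distrib_left by (subst sum.swap, intro sum.cong refl) (simp only: mult_ac)
    also have "\<dots> = (\<Sum>k\<in>specht_basis lam. specht_matrix lam \<pi> i k * specht_coord lam (\<theta> v) k)"
      by (intro sum.cong refl) (simp add: coord_\<theta> sum_distrib_left)
    also have "\<dots> = specht_coord lam (tabloid_action \<pi> (\<theta> v)) i"
      by (rule coord_action[OF \<pi>' \<theta>, symmetric])
    finally show "specht_coord lam (\<theta> (tabloid_action \<pi> v)) i = specht_coord lam (tabloid_action \<pi> (\<theta> v)) i" .
  qed (rule \<theta>)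
  obtain t where t: "is_tableau lam t"
    using tableau_exists by blast
  define N where "N = (of_nat (card (column_stabilizer lam t)) :: complex)"
  have N: "N \<noteq> 0"
    using column_stabilizer_id[of lam t] by (auto simp: N_def card_eq_0_iff)
  obtain a where a: "column_antisymmetrizer lam t (\<theta> (polytabloid lam t)) = cscale a (polytabloid lam t)"
    using antisymmetrizer_tabloid_module[OF lam t] \<theta> specht_module_subset by blast
  have stab: "\<pi> permutes {1..n}" "\<pi> permutes {1..sum_list lam}" if "\<pi> \<in> column_stabilizer lam t" for \<pi>
    using column_stabilizer_permutes[OF that] n by simp_all
  note e = polytabloid_in_specht[OF t]
  \<comment> \<open>The eigenvalue \<open>N\<close> of the antisymmetrizer on the polytabloid is
    nonzero, so the eigenvalue of \<open>\<theta>\<close> will be \<open>a / N\<close>.\<close>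
  have "cscale N (\<theta> (polytabloid lam t)) = \<theta> (column_antisymmetrizer lam t (polytabloid lam t))"
    unfolding antisymmetrizer_polytabloid N_def[symmetric] by (rule \<theta>_scale[OF e, symmetric])
  also have "\<dots> = column_antisymmetrizer lam t (\<theta> (polytabloid lam t))"
  proof -
    have "\<theta> (column_antisymmetrizer lam t (polytabloid lam t)) =
          (\<Sum>\<pi>\<in>column_stabilizer lam t. cscale (of_int (sign \<pi>)) (\<theta> (tabloid_action \<pi> (polytabloid lam t))))"
      unfolding column_antisymmetrizer_def
      by (rule \<theta>_combination) (rule tabloid_action_specht[OF stab(2) e])
    then show ?thesis
      unfolding column_antisymmetrizer_def[of lam t "\<theta> (polytabloid lam t)"]
      by (simp only: \<theta>_action[OF stab(1) e] cong: sum.cong)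
  qed
  finally have Na: "cscale N (\<theta> (polytabloid lam t)) = cscale a (polytabloid lam t)"
    using a by simp
  define c where "c = a / N"
  have et: "\<theta> (polytabloid lam t) = cscale c (polytabloid lam t)"
  proof
    fix T
    have "N * \<theta> (polytabloid lam t) T = a * polytabloid lam t T"
      using fun_cong[OF Na] by simp
    then show "\<theta> (polytabloid lam t) T = c * polytabloid lam t T"
      using N by (simp add: c_def field_simps)
  qed
  have es: "\<theta> (polytabloid lam s) = cscale c (polytabloid lam s)" if s: "is_tableau lam s" for s
  proof -
    obtain \<pi> where \<pi>: "\<pi> permutes {1..sum_list lam}" "polytabloid lam s = polytabloid lam (\<pi> \<circ> t)"
      by (rule tableau_transitive[OF t s])
    then have "polytabloid lam s = tabloid_action \<pi> (polytabloid lam t)"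
      by (simp add: tabloid_action_polytabloid)
    then show ?thesis
      using \<theta>_action[of \<pi>, OF _ e] \<pi>(1) n et tabloid_action_cscale by simp
  qed
  have scalar: "\<theta> v = cscale c v" if "v \<in> specht_module lam" for v
  proof -
    \<comment> \<open>Membership is carried through the induction, as \<open>\<theta>\<close> is
      linear only on the module.\<close>
    have "v \<in> specht_module lam \<and> \<theta> v = cscale c v"
      using that unfolding specht_module_def
    proof (induction rule: cfun.span_induct)
      show "cfun.subspace {v. v \<in> cfun.span {polytabloid lam t |t. is_tableau lam t} \<and> \<theta> v = cscale c v}"
        unfolding specht_module_def[symmetric]
      proof (rule cfun.subspaceI)
        have "0 \<in> specht_module lam"
          by (rule cfun.subspace_0[OF specht_subspace])
        then show "0 \<in> {v. v \<in> specht_module lam \<and> \<theta> v = cscale c v}"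
          using \<theta>_scale[of 0 0] by (simp add: zero_fun_def)
      next
        fix u v
        assume "u \<in> {v. v \<in> specht_module lam \<and> \<theta> v = cscale c v}" "v \<in> {v. v \<in> specht_module lam \<and> \<theta> v = cscale c v}"
        then show "u + v \<in> {v. v \<in> specht_module lam \<and> \<theta> v = cscale c v}"
          by (simp add: \<theta>_add cfun.subspace_add[OF specht_subspace] fun_eq_iff distrib_left)
      next
        fix d v
        assume "v \<in> {v. v \<in> specht_module lam \<and> \<theta> v = cscale c v}"
        then show "cscale d v \<in> {v. v \<in> specht_module lam \<and> \<theta> v = cscale c v}"
          by (simp add: \<theta>_scale cfun.subspace_scale[OF specht_subspace] fun_eq_iff mult.left_commute)
      qed
    next
      fix v
      assume "v \<in> {polytabloid lam t |t. is_tableau lam t}"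
      then obtain s where s: "is_tableau lam s" "v = polytabloid lam s"
        by blast
      then show "v \<in> cfun.span {polytabloid lam t |t. is_tableau lam t} \<and> \<theta> v = cscale c v"
        using es[OF s(1)] polytabloid_in_specht[OF s(1)] unfolding specht_module_def by simp
    qed
    then show ?thesis ..
  qed
  have "A i j = c * of_bool (i = j)" if ij: "i \<in> specht_basis lam" "j \<in> specht_basis lam" for i j
  proof -
    have "A i j = (\<Sum>k\<in>specht_basis lam. if k = j then A i k else 0)"
      using ij by simp
    also have "\<dots> = (\<Sum>k\<in>specht_basis lam. specht_coord lam j k * A i k)"
      by (intro sum.cong refl) (simp add: coord_basis ij)
    also have "\<dots> = specht_coord lam (\<theta> j) i"
      by (rule coord_\<theta>[OF ij(1), symmetric])
    also have "\<dots> = c * specht_coord lam j i"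
      unfolding scalar[OF specht_basis_subset[OF ij(2)]]
      using coord_combination[of "{()}" "\<lambda>_. j" lam "\<lambda>_. c" i] specht_basis_subset[OF ij(2)] by simp
    finally show ?thesis
      by (simp add: coord_basis ij)
  qed
  then show ?thesis
    by blast
qed

lemma specht_schurian:
  assumes lam: "is_partition n lam"
  shows "sym_schurian_rep (specht_basis lam) (specht_matrix lam) n"
proof -
  interpret group "sym_group n" by (rule sym_group_is_group)
  have n: "sum_list lam = n"
    using lam by (simp add: is_partition_def)
  show ?thesis
  proof unfold_locales
    show "finite (carrier (sym_group n))"
      by (simp add: sym_group_def finite_permutations)
    show "finite (specht_basis lam)"
      by simp
    obtain t where t: "is_tableau lam t"
      using tableau_exists by blast
    show "specht_basis lam \<noteq> {}"
    proof
      assume "specht_basis lam = {}"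
      then have "polytabloid lam t \<in> {0}"
        using polytabloid_in_specht[OF t] span_specht_basis[of lam] by simp
      then show False
        using polytabloid_nonzero[OF t] by simp
    qed
  next
    fix i j
    assume "i \<in> specht_basis lam" "j \<in> specht_basis lam"
    then show "specht_matrix lam \<one>\<^bsub>sym_group n\<^esub> i j = of_bool (i = j)"
      by (simp add: sym_group_one specht_matrix_def tabloid_action_id coord_basis)
  next
    fix g h i j
    assume g: "g \<in> carrier (sym_group n)" and h: "h \<in> carrier (sym_group n)" and "i \<in> specht_basis lam" and j: "j \<in> specht_basis lam"
    have perm: "g permutes {1..sum_list lam}" "h permutes {1..sum_list lam}"
      using g h n by (simp_all add: sym_group_carrier)
    have "tabloid_action (g \<circ> h) j = tabloid_action g (tabloid_action h j)"
      using perm by (intro tabloid_action_compose permutes_bij)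
    then show "specht_matrix lam (g \<otimes>\<^bsub>sym_group n\<^esub> h) i j =
               (\<Sum>k\<in>specht_basis lam. specht_matrix lam g i k * specht_matrix lam h k j)"
      using coord_action[OF perm(1) tabloid_action_specht[OF perm(2) specht_basis_subset[OF j]], of i]
      by (simp add: sym_group_mult specht_matrix_def)
  next
    fix A :: "(nat set list \<Rightarrow> complex) \<Rightarrow> (nat set list \<Rightarrow> complex) \<Rightarrow> complex"
    assume "\<And>g i j. g \<in> carrier (sym_group n) \<Longrightarrow> i \<in> specht_basis lam \<Longrightarrow> j \<in> specht_basis lam \<Longrightarrow>
      (\<Sum>k\<in>specht_basis lam. specht_matrix lam g i k * A k j) = (\<Sum>k\<in>specht_basis lam. A i k * specht_matrix lam g k j)"
    then show "\<exists>c. \<forall>i\<in>specht_basis lam. \<forall>j\<in>specht_basis lam. A i j = c * of_bool (i = j)"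
      by (intro specht_commutant[OF lam]) (simp add: sym_group_carrier)
  qed
qed

lemma chi_eq_character:
  assumes "is_partition n lam"
  shows "chi lam \<pi> = finite_matrix_rep.character (specht_basis lam) (specht_matrix lam) \<pi>"
proof -
  interpret sym_schurian_rep "specht_basis lam" "specht_matrix lam" n
    by (rule specht_schurian[OF assms])
  show ?thesis
    by (simp add: chi_eq_trace character_def)
qed

text \<open>The trace of the antisymmetrizer of a \<open>mu\<close>-tableau on the Specht module of
  \<open>lam\<close>; the two shapes need only have the same size.\<close>

lemma signed_chi_sum:
  assumes n: "sum_list mu = sum_list lam"
  shows "(\<Sum>\<pi>\<in>column_stabilizer mu t. of_int (sign \<pi>) * chi lam \<pi>) =
         (\<Sum>b\<in>specht_basis lam. specht_coord lam (column_antisymmetrizer mu t b) b)"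
proof -
  have "specht_coord lam (column_antisymmetrizer mu t b) b =
        (\<Sum>\<pi>\<in>column_stabilizer mu t. of_int (sign \<pi>) * specht_matrix lam \<pi> b b)" if b: "b \<in> specht_basis lam" for b
  proof -
    have "tabloid_action \<pi> b \<in> specht_module lam" if "\<pi> \<in> column_stabilizer mu t" for \<pi>
      using column_stabilizer_permutes[OF that] n by (intro tabloid_action_specht specht_basis_subset[OF b]) simp
    then show ?thesis
      unfolding column_antisymmetrizer_def specht_matrix_def by (rule coord_combination)
  qed
  then show ?thesis
    by (simp add: chi_eq_trace sum_distrib_left sum.swap[of _ "specht_basis lam"])
qed

text \<open>On its own Specht module the antisymmetrizer has rank one, with image the line of the
  polytabloid, so its trace is the eigenvalue there. Expanding \<open>?e\<close> in the basis and
  applying the antisymmetrizer exhibits that trace.\<close>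

lemma signed_chi_sum_own:
  assumes lam: "is_partition n lam" and t: "is_tableau lam t"
  shows "(\<Sum>\<pi>\<in>column_stabilizer lam t. of_int (sign \<pi>) * chi lam \<pi>) = of_nat (card (column_stabilizer lam t))"
proof -
  let ?e = "polytabloid lam t"
  note e = polytabloid_in_specht[OF t]
  have "\<exists>c. column_antisymmetrizer lam t b = cscale c ?e" if "b \<in> specht_basis lam" for b
    using antisymmetrizer_tabloid_module[OF lam t] specht_basis_subset[OF that] specht_module_subset by blast
  then obtain c where c: "\<And>b. b \<in> specht_basis lam \<Longrightarrow> column_antisymmetrizer lam t b = cscale (c b) ?e"
    by metis
  have coord: "specht_coord lam (column_antisymmetrizer lam t b) b = c b * specht_coord lam ?e b" if "b \<in> specht_basis lam" for b
    unfolding c[OF that] using coord_combination[of "{()}" "\<lambda>_. ?e" lam "\<lambda>_. c b" b] e by simp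
  obtain T where T: "?e T \<noteq> 0"
    using polytabloid_nonzero[OF t] by (auto simp: fun_eq_iff)
  have "column_antisymmetrizer lam t ?e = column_antisymmetrizer lam t (\<Sum>b\<in>specht_basis lam. cscale (specht_coord lam ?e b) b)"
    by (simp only: coord_expansion[OF e])
  also have "\<dots> = (\<Sum>b\<in>specht_basis lam. cscale (specht_coord lam ?e b) (cscale (c b) ?e))"
    unfolding column_antisymmetrizer_sum column_antisymmetrizer_cscale by (intro sum.cong refl) (simp add: c)
  finally have eq: "column_antisymmetrizer lam t ?e = (\<Sum>b\<in>specht_basis lam. cscale (specht_coord lam ?e b) (cscale (c b) ?e))" .
  have "of_nat (card (column_stabilizer lam t)) * ?e T = (\<Sum>b\<in>specht_basis lam. specht_coord lam ?e b * (c b * ?e T))"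
    using fun_cong[OF eq, of T] unfolding antisymmetrizer_polytabloid sum_fun_apply .
  also have "\<dots> = (\<Sum>b\<in>specht_basis lam. c b * specht_coord lam ?e b) * ?e T"
    unfolding sum_distrib_right by (intro sum.cong refl) (simp only: mult_ac)
  finally show ?thesis
    using T by (simp add: signed_chi_sum coord)
qed

text \<open>The signed sum over the column stabilizer of a \<open>lam\<close>-tableau separates the
  characters: it is positive for \<open>chi lam\<close>, but vanishes for \<open>chi mu\<close> if
  \<open>lam\<close> does not dominate \<open>mu\<close>.\<close>

lemma chi_le:
  assumes lam: "is_partition n lam" and mu: "is_partition n mu"
    and eq: "\<And>\<pi>. \<pi> permutes {1..n} \<Longrightarrow> chi lam \<pi> = chi mu \<pi>"
  shows "sum_list (take k mu) \<le> sum_list (take k lam)"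
proof (rule ccontr)
  assume k: "\<not> ?thesis"
  obtain t where t: "is_tableau lam t"
    using tableau_exists by blast
  have n: "sum_list lam = n" "sum_list mu = n"
    using lam mu by (simp_all add: is_partition_def)
  have "(\<Sum>\<pi>\<in>column_stabilizer lam t. of_int (sign \<pi>) * chi mu \<pi>) = 0"
  proof -
    have "column_antisymmetrizer lam t b = 0" if "b \<in> specht_basis mu" for b
      using antisymmetrizer_tabloid_module_eq_0[OF lam mu t, of k] k specht_basis_subset[OF that]
        specht_module_subset by (auto simp: not_le)
    then show ?thesis
      using n by (simp add: signed_chi_sum cfun.representation_zero)
  qed
  moreover have "(\<Sum>\<pi>\<in>column_stabilizer lam t. of_int (sign \<pi>) * chi mu \<pi>) =
                 (\<Sum>\<pi>\<in>column_stabilizer lam t. of_int (sign \<pi>) * chi lam \<pi>)"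
    using eq column_stabilizer_permutes n by (intro sum.cong refl) metis
  ultimately have "card (column_stabilizer lam t) = 0"
    using signed_chi_sum_own[OF lam t] by simp
  then show False
    using column_stabilizer_id[of lam t] by (auto simp: card_eq_0_iff)
qed

lemma chi_inj:
  assumes "is_partition n lam" "is_partition n mu"
    and "\<And>\<pi>. \<pi> permutes {1..n} \<Longrightarrow> chi lam \<pi> = chi mu \<pi>"
  shows "lam = mu"
  using assms by (intro partition_eqI[of n] le_antisym chi_le[of n]) simp_all

section \<open>Identification of an irreducible character\<close>

text \<open>The unnormalized bilinear form of character theory, with the inverse in place of
  conjugation.\<close>

definition class_pairing ::
    "nat \<Rightarrow> ((nat \<Rightarrow> nat) \<Rightarrow> complex) \<Rightarrow> ((nat \<Rightarrow> nat) \<Rightarrow> complex) \<Rightarrow> complex" where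
  "class_pairing n F H = (\<Sum>\<pi> | \<pi> permutes {1..n}. F \<pi> * H (inv' \<pi>))"

lemma class_pairing_cong:
  assumes "\<And>\<pi>. \<pi> permutes {1..n} \<Longrightarrow> F \<pi> = F' \<pi>" "\<And>\<pi>. \<pi> permutes {1..n} \<Longrightarrow> H \<pi> = H' \<pi>"
  shows "class_pairing n F H = class_pairing n F' H'"
  unfolding class_pairing_def using assms by (intro sum.cong refl) (simp add: permutes_inv)

lemma class_pairing_characters:
  assumes "sym_schurian_rep I R n" "sym_schurian_rep J Q n"
    and "class_pairing n (finite_matrix_rep.character I R) (finite_matrix_rep.character J Q) \<noteq> 0"
    and \<pi>: "\<pi> permutes {1..n}"
  shows "finite_matrix_rep.character I R \<pi> = finite_matrix_rep.character J Q \<pi>"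
proof (rule characters_eq_if_not_orthogonal)
  show "schurian_rep (sym_group n) I R" "schurian_rep (sym_group n) J Q"
    using assms(1,2) by (simp_all add: sym_schurian_rep_def)
  show "\<pi> \<in> carrier (sym_group n)"
    using \<pi> by (simp add: sym_group_carrier)
  have "(\<Sum>g\<in>carrier (sym_group n). finite_matrix_rep.character I R g *
          finite_matrix_rep.character J Q (inv\<^bsub>sym_group n\<^esub> g)) =
        class_pairing n (finite_matrix_rep.character I R) (finite_matrix_rep.character J Q)"
    unfolding class_pairing_def
    by (intro sum.cong) (auto simp: sym_group_carrier sym_group_inv_equality)
  with assms(3) show "(\<Sum>g\<in>carrier (sym_group n). finite_matrix_rep.character I R g *
          finite_matrix_rep.character J Q (inv\<^bsub>sym_group n\<^esub> g)) \<noteq> 0"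
    by simp
qed

lemma class_pairing_norm:
  assumes "sym_schurian_rep I R n"
  shows "class_pairing n (finite_matrix_rep.character I R) (finite_matrix_rep.character I R) \<noteq> 0"
proof -
  interpret sym_schurian_rep I R n by fact
  have "class_pairing n character character =
        (\<Sum>g\<in>carrier (sym_group n). character g * character (inv\<^bsub>sym_group n\<^esub> g))"
    unfolding class_pairing_def
    by (intro sum.cong) (auto simp: sym_group_carrier sym_group_inv_equality)
  then show ?thesis
    using character_norm finite_carrier carrier_not_empty by simp
qed

text \<open>The form is bilinear rather than positive definite, so nonvanishing of each
  \<open>class_pairing n u u\<close> has to be supplied.\<close>

lemma independent_if_orthogonal:
  assumes fin: "finite S"
    and norm: "\<And>u. u \<in> S \<Longrightarrow> class_pairing n u u \<noteq> 0"
    and orth: "\<And>u v. u \<in> S \<Longrightarrow> v \<in> S \<Longrightarrow> u \<noteq> v \<Longrightarrow> class_pairing n u v = 0"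
  shows "cfun.independent S"
proof (rule cfun.independent_if_scalars_zero[OF fin])
  fix c :: "((nat \<Rightarrow> nat) \<Rightarrow> complex) \<Rightarrow> complex" and w
  assume zero: "(\<Sum>u\<in>S. cscale (c u) u) = 0" and w: "w \<in> S"
  have "0 = class_pairing n (\<Sum>u\<in>S. cscale (c u) u) w"
    by (simp add: zero class_pairing_def)
  also have "\<dots> = (\<Sum>\<pi> | \<pi> permutes {1..n}. \<Sum>u\<in>S. c u * (u \<pi> * w (inv' \<pi>)))"
    by (simp add: class_pairing_def sum_fun_apply sum_distrib_right mult.assoc)
  also have "\<dots> = (\<Sum>u\<in>S. c u * class_pairing n u w)"
    unfolding class_pairing_def sum_distrib_left by (rule sum.swap)
  also have "\<dots> = (\<Sum>u\<in>S. if u = w then c w * class_pairing n w w else 0)"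
    using orth[OF _ w] by (intro sum.cong refl) simp
  also have "\<dots> = c w * class_pairing n w w"
    using fin w by simp
  finally show "c w = 0"
    using norm[OF w] by simp
qed

lemma class_functions_in_span:
  fixes F :: "(nat \<Rightarrow> nat) \<Rightarrow> complex"
  assumes type: "\<And>\<pi>. \<pi> permutes {1..n} \<Longrightarrow> is_partition n (ty \<pi>)"
    and F: "\<And>\<pi> \<sigma>. \<pi> permutes {1..n} \<Longrightarrow> \<sigma> permutes {1..n} \<Longrightarrow> ty \<pi> = ty \<sigma> \<Longrightarrow> F \<pi> = F \<sigma>"
    and outside: "\<And>\<pi>. \<not> \<pi> permutes {1..n} \<Longrightarrow> F \<pi> = 0"
  shows "F \<in> cfun.span ((\<lambda>lam \<pi>. of_bool (\<pi> permutes {1..n} \<and> ty \<pi> = lam)) ` {lam. is_partition n lam})"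
    (is "F \<in> cfun.span (?cls ` ?P)")
proof -
  \<comment> \<open>If no permutation has type \<open>lam\<close>, the chosen value is arbitrary but
    is multiplied by an indicator that vanishes everywhere.\<close>
  define rep where "rep lam = (SOME \<pi>. \<pi> permutes {1..n} \<and> ty \<pi> = lam)" for lam
  have "F = (\<Sum>lam\<in>?P. cscale (F (rep lam)) (?cls lam))"
  proof
    fix \<pi>
    show "F \<pi> = (\<Sum>lam\<in>?P. cscale (F (rep lam)) (?cls lam)) \<pi>"
    proof (cases "\<pi> permutes {1..n}")
      case True
      then have "rep (ty \<pi>) permutes {1..n} \<and> ty (rep (ty \<pi>)) = ty \<pi>"
        unfolding rep_def
        by (intro someI[of "\<lambda>\<sigma>. \<sigma> permutes {1..n} \<and> ty \<sigma> = ty \<pi>" \<pi>]) simp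
      then have "F (rep (ty \<pi>)) = F \<pi>"
        using F[of "rep (ty \<pi>)" \<pi>] True by simp
      moreover have "(\<Sum>lam\<in>?P. cscale (F (rep lam)) (?cls lam)) \<pi> =
          (\<Sum>lam\<in>?P. if lam = ty \<pi> then F (rep lam) else 0)"
        unfolding sum_fun_apply by (intro sum.cong refl) (use True in auto)
      ultimately show ?thesis
        using type[OF True] by (simp add: finite_partitions)
    next
      case False
      then show ?thesis
        by (simp add: sum_fun_apply outside)
    qed
  qed
  also have "\<dots> \<in> cfun.span (?cls ` ?P)"
    by (intro cfun.span_sum cfun.span_scale cfun.span_base imageI)
  finally show ?thesis .
qed

text \<open>
  The irreducible characters are linearly independent class functions, and the \<open>chi lam\<close> are already
  as many as there are cycle types.
\<close>

lemma irreducible_character_is_chi: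
  assumes rep: "sym_schurian_rep I R n"
    and f: "\<And>\<pi>. \<pi> permutes {1..n} \<Longrightarrow> f \<pi> = finite_matrix_rep.character I R \<pi>"
  obtains lam where "is_partition n lam" "\<And>\<pi>. \<pi> permutes {1..n} \<Longrightarrow> f \<pi> = chi lam \<pi>"
proof -
  let ?P = "{lam. is_partition n lam}"
  \<comment> \<open>A character has arbitrary values off the group. Setting them to 0 makes equality
    of functions mean equality on the group and allows counting in the function space.\<close>
  define restr :: "((nat \<Rightarrow> nat) \<Rightarrow> complex) \<Rightarrow> (nat \<Rightarrow> nat) \<Rightarrow> complex"
    where "restr F = (\<lambda>\<pi>. if \<pi> permutes {1..n} then F \<pi> else 0)" for F
  define ty where "ty \<pi> = (SOME lam. is_partition n lam \<and> has_cycle_type {1..n} lam \<pi>)" for \<pi> :: "nat \<Rightarrow> nat"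
  have ty: "is_partition n (ty \<pi>)" "has_cycle_type {1..n} (ty \<pi>) \<pi>" if "\<pi> permutes {1..n}" for \<pi>
  proof -
    have "\<exists>lam. is_partition n lam \<and> has_cycle_type {1..n} lam \<pi>"
      using cycle_type_exists[OF that] by blast
    then have "is_partition n (ty \<pi>) \<and> has_cycle_type {1..n} (ty \<pi>) \<pi>"
      unfolding ty_def by (rule someI_ex)
    then show "is_partition n (ty \<pi>)" "has_cycle_type {1..n} (ty \<pi>) \<pi>" by blast+
  qed
  let ?T = "(\<lambda>lam \<pi>. of_bool (\<pi> permutes {1..n} \<and> ty \<pi> = lam) :: complex) ` ?P"
  let ?S = "insert (restr f) ((\<lambda>lam. restr (chi lam)) ` ?P)"
  \<comment> \<open>The index type is left open, because this is applied both to the representation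
    of \<open>f\<close> and to Specht bases.\<close>
  have in_span: "restr F \<in> cfun.span ?T"
    if F: "\<And>\<pi>. \<pi> permutes {1..n} \<Longrightarrow> F \<pi> = finite_matrix_rep.character J Q \<pi>"
      and JQ: "sym_schurian_rep J Q n" for F and J :: "'j set" and Q
  proof (rule class_functions_in_span)
    fix \<pi> \<sigma>
    assume perm: "\<pi> permutes {1..n}" "\<sigma> permutes {1..n}" and same: "ty \<pi> = ty \<sigma>"
    have "has_cycle_type {1..n} (ty \<pi>) \<sigma>"
      using ty(2)[OF perm(2)] same by simp
    then have "finite_matrix_rep.character J Q \<pi> = finite_matrix_rep.character J Q \<sigma>"
      by (rule sym_schurian_rep.character_same_cycle_type[OF JQ perm ty(2)[OF perm(1)]])
    then show "restr F \<pi> = restr F \<sigma>"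
      using F[OF perm(1)] F[OF perm(2)] perm by (simp add: restr_def)
  qed (simp_all add: restr_def ty)
  have chi: "sym_schurian_rep (specht_basis lam) (specht_matrix lam) n"
    "\<And>\<pi>. chi lam \<pi> = finite_matrix_rep.character (specht_basis lam) (specht_matrix lam) \<pi>"
    if "is_partition n lam" for lam
    using specht_schurian[OF that] chi_eq_character[OF that] by auto
  have restr_pairing: "class_pairing n (restr F) (restr H) = class_pairing n F H" for F H
    by (rule class_pairing_cong) (simp_all add: restr_def)
  have restr_eq: "restr F = restr H \<longleftrightarrow> (\<forall>\<pi>. \<pi> permutes {1..n} \<longrightarrow> F \<pi> = H \<pi>)" for F H
    by (auto simp: restr_def fun_eq_iff)
  have "\<exists>lam\<in>?P. restr f = restr (chi lam)"
  proof (rule ccontr)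
    assume none: "\<not> ?thesis"
    \<comment> \<open>If \<open>f\<close> were new, \<open>?S\<close> would be an independent set of
      \<open>card ?P + 1\<close> elements in the span of at most \<open>card ?P\<close> class
      indicators.\<close>
    have inj: "inj_on (\<lambda>lam. restr (chi lam)) ?P"
      by (rule inj_onI) (auto simp: restr_eq intro: chi_inj)
    have card: "card ?S = Suc (card ?P)"
      using none by (subst card_insert_disjoint) (auto simp: finite_partitions card_image[OF inj])
    have f_pairing: "class_pairing n f H = class_pairing n (finite_matrix_rep.character I R) H"
      "class_pairing n H f = class_pairing n H (finite_matrix_rep.character I R)" for H
      using f by (auto intro: class_pairing_cong)
    have chi_pairing: "class_pairing n (chi lam) H =
        class_pairing n (finite_matrix_rep.character (specht_basis lam) (specht_matrix lam)) H"
      "class_pairing n H (chi lam) =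
        class_pairing n H (finite_matrix_rep.character (specht_basis lam) (specht_matrix lam))"
      if "is_partition n lam" for lam H
      using chi(2)[OF that] by (auto intro: class_pairing_cong)
    have ind: "cfun.independent ?S"
    proof (rule independent_if_orthogonal[of _ n])
      show "finite ?S"
        by (simp add: finite_partitions)
      show "class_pairing n u u \<noteq> 0" if "u \<in> ?S" for u
        using that class_pairing_norm[OF rep] class_pairing_norm[OF chi(1)]
        by (auto simp: restr_pairing f_pairing chi_pairing)
      fix u v
      assume uv: "u \<in> ?S" "v \<in> ?S" "u \<noteq> v"
      have f_chi: "class_pairing n f (chi lam) = 0" "class_pairing n (chi lam) f = 0"
        if lam: "is_partition n lam" for lam
      proof -
        have ne: "\<not> (\<forall>\<pi>. \<pi> permutes {1..n} \<longrightarrow> f \<pi> = chi lam \<pi>)"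
          using none lam restr_eq by blast
        show "class_pairing n f (chi lam) = 0"
          using class_pairing_characters[OF rep chi(1)[OF lam]] ne f chi(2)[OF lam]
          unfolding f_pairing chi_pairing[OF lam] by metis
        show "class_pairing n (chi lam) f = 0"
          using class_pairing_characters[OF chi(1)[OF lam] rep] ne f chi(2)[OF lam]
          unfolding f_pairing chi_pairing[OF lam] by metis
      qed
      have chi_chi: "class_pairing n (chi lam) (chi mu) = 0"
        if lm: "is_partition n lam" "is_partition n mu" and ne: "restr (chi lam) \<noteq> restr (chi mu)" for lam mu
        using class_pairing_characters[OF chi(1)[OF lm(1)] chi(1)[OF lm(2)]] ne
          chi(2)[OF lm(1)] chi(2)[OF lm(2)]
        unfolding chi_pairing[OF lm(1)] chi_pairing[OF lm(2)] restr_eq by metis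
      show "class_pairing n u v = 0"
        using uv f_chi chi_chi by (auto simp: restr_pairing)
    qed
    have "?S \<subseteq> cfun.span ?T"
      using in_span[OF f rep] in_span[OF chi(2) chi(1)] by blast
    then have "card ?S \<le> card ?T"
      using cfun.independent_span_bound[OF finite_imageI[OF finite_partitions] ind] by blast
    also have "\<dots> \<le> card ?P"
      by (rule card_image_le[OF finite_partitions])
    finally show False
      using card by simp
  qed
  then show thesis
    using that by (auto simp: restr_eq)
qed

text \<open>Embeds a non-adaptive strategy into the tree-shaped query algorithms.\<close>

primrec query_all :: "(nat \<Rightarrow> nat) list \<Rightarrow> (complex list \<Rightarrow> 'r) \<Rightarrow> 'r query_algorithm" where
  "query_all [] k = Halt (k [])"
| "query_all (\<pi> # \<pi>s) k = Query \<pi> (\<lambda>z. query_all \<pi>s (\<lambda>zs. k (z # zs)))"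

lemma answer_query_all: "answer (query_all \<pi>s k) f = k (map f \<pi>s)"
  by (induction \<pi>s arbitrary: k) simp_all

lemma queries_query_all: "queries (query_all \<pi>s k) f = \<pi>s"
  by (induction \<pi>s arbitrary: k) simp_all

lemma chi_determined_by_cycles:
  assumes "n > 0" and lam: "is_partition n lam" and mu: "is_partition n mu"
    and cycles: "\<And>k. 1 \<le> k \<Longrightarrow> k \<le> n \<Longrightarrow> chi lam (standard_cycle k) = chi mu (standard_cycle k)"
  shows "lam = mu"
proof (rule chi_inj[OF lam mu])
  fix \<pi>
  assume "\<pi> permutes {1..n}"
  then show "chi lam \<pi> = chi mu \<pi>"
    unfolding chi_eq_character[OF lam] chi_eq_character[OF mu]
    by (rule characters_determined_by_cycles[OF specht_schurian[OF lam] specht_schurian[OF mu] \<open>n > 0\<close>, rotated])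
       (use cycles chi_eq_character[OF lam] chi_eq_character[OF mu] in auto)
qed

theorem theorem1:
  shows "\<exists>(alg :: nat \<Rightarrow> nat list query_algorithm) (p :: real poly).
    \<forall>n>0. \<forall>f. irreducible_character n f \<longrightarrow>
      set (queries (alg n) f) \<subseteq> carrier (sym_group n) \<and>
      real (length (queries (alg n) f)) \<le> poly p (real n) \<and>
      {lam. is_partition n lam \<and> (\<forall>\<pi>\<in>carrier (sym_group n). f \<pi> = chi lam \<pi>)}
        = {answer (alg n) f}"
proof -
  define cycles where "cycles n = map standard_cycle [1..<Suc n]" for n
  \<comment> \<open>Unrestricted choice is admissible here because only queries are counted;
    injectivity on the cycles will make the choice unique.\<close>
  define decode where "decode n zs = (SOME lam. is_partition n lam \<and> map (chi lam) (cycles n) = zs)" for n zs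
  define alg where "alg n = query_all (cycles n) (decode n)" for n
  \<comment> \<open>\<open>[:0, 1:]\<close> is the polynomial X, since exactly \<open>n\<close>
    queries are made.\<close>
  have "set (queries (alg n) f) \<subseteq> carrier (sym_group n) \<and>
      real (length (queries (alg n) f)) \<le> poly [:0, 1:] (real n) \<and>
      {lam. is_partition n lam \<and> (\<forall>\<pi>\<in>carrier (sym_group n). f \<pi> = chi lam \<pi>)} = {answer (alg n) f}"
    if n: "n > 0" and irr: "irreducible_character n f" for n f
  proof -
    have perm: "set (cycles n) \<subseteq> carrier (sym_group n)"
      using standard_cycle_permutes by (auto simp: cycles_def sym_group_carrier)
    obtain d R where rep: "schurian_rep (sym_group n) {..<d::nat} R"
      and char: "\<And>g. g \<in> carrier (sym_group n) \<Longrightarrow> f g = finite_matrix_rep.character {..<d} R g"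
      by (rule irreducible_character_schurian[OF irr]) (rule that)
    have rep: "sym_schurian_rep {..<d} R n"
      using rep by (rule sym_schurian_rep.intro)
    have char: "f \<pi> = finite_matrix_rep.character {..<d} R \<pi>" if "\<pi> permutes {1..n}" for \<pi>
      using char that by (simp add: sym_group_carrier)
    obtain lam where lam: "is_partition n lam" and "\<And>\<pi>. \<pi> permutes {1..n} \<Longrightarrow> f \<pi> = chi lam \<pi>"
      by (rule irreducible_character_is_chi[OF rep char]) (assumption | rule that)+
    then have f: "\<And>\<pi>. \<pi> \<in> carrier (sym_group n) \<Longrightarrow> f \<pi> = chi lam \<pi>"
      by (simp add: sym_group_carrier)
    \<comment> \<open>Used twice: it forces the decoder to return \<open>lam\<close>, and it
      excludes a second partition in the solution set.\<close>
    have unique: "mu = lam" if mu: "is_partition n mu" "map (chi mu) (cycles n) = map f (cycles n)" for mu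
    proof (rule chi_determined_by_cycles[OF n mu(1) lam])
      fix k
      assume k: "1 \<le> k" "k \<le> n"
      then have "standard_cycle k \<in> set (cycles n)"
        by (simp add: cycles_def del: upt_Suc)
      then show "chi mu (standard_cycle k) = chi lam (standard_cycle k)"
        using mu(2) f perm by (metis map_eq_conv subsetD)
    qed
    have lam_cycles: "map (chi lam) (cycles n) = map f (cycles n)"
      using f perm by (simp add: subset_iff)
    have "decode n (map f (cycles n)) = lam"
      unfolding decode_def
    proof (rule some_equality)
      show "is_partition n lam \<and> map (chi lam) (cycles n) = map f (cycles n)"
        using lam lam_cycles by (rule conjI)
      show "mu = lam" if "is_partition n mu \<and> map (chi mu) (cycles n) = map f (cycles n)" for mu
        using that unique by blast
    qed
    then have "answer (alg n) f = lam"
      by (simp add: alg_def answer_query_all)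
    moreover have "mu = lam" if "is_partition n mu" "\<forall>\<pi>\<in>carrier (sym_group n). f \<pi> = chi mu \<pi>" for mu
    proof (rule unique[OF that(1)])
      show "map (chi mu) (cycles n) = map f (cycles n)"
        using that(2) perm by (simp add: subset_iff)
    qed
    ultimately have "{lam. is_partition n lam \<and> (\<forall>\<pi>\<in>carrier (sym_group n). f \<pi> = chi lam \<pi>)} =
        {answer (alg n) f}"
      using lam f by blast
    moreover have "queries (alg n) f = cycles n"
      by (simp only: alg_def queries_query_all)
    moreover have "length (cycles n) = n"
      by (simp add: cycles_def)
    ultimately show ?thesis
      using perm by simp
  qed
  then show ?thesis
    by blast
qed

end
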